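(* Let $b\ge2$ be a fixed integer and, for $h\in\mathbb N$, let $T_h^{\rm reg}$ be the rooted complete regular $b$-ary tree of height $h$, with $n_h=(b^{h+1}-1)/(b-1)$ vertices. Fix $c>0$, perform Bernoulli bond percolation on $T_h^{\rm reg}$ with parameter $p_h=e^{-c/h}$, and let $G_h^{\rm reg}$ be the number of vertices of the cluster containing the root. In the regime where $h\to\infty$ with $\{\log_bh\}\to\rho\in[0,1)$, there is the convergence in distribution $$\left(\frac{G_h^{\rm reg}}{n_h}-e^{-c}\right)h-ce^{-c}\log_bh\ \xrightarrow{d}\ -e^{-c}\left(L_\rho(c)+c\rho-\frac{c}{b-1}\right).$$
   Context: In $T_h^{\rm reg}$ every vertex at distance less than $h$ from the root has exactly $b$ children and there are $b^k$ vertices at distance $k=0,1,\dots,h$ from the root. Bernoulli bond percolation with parameter $p$: each edge is removed with probability $1-p$, independently of the other edges; clusters are the connected components that remain. $\log_bx=\ln x/\ln b$, and $y=\lfloor y\rfloor+\{y\}$ is the decomposition of a real $y$ into integer and fractional parts. For $\rho\in[0,1)$ and $x>0$ let $\bar\Lambda_\rho(x)=\frac{b^{-\rho+\lfloor\rho-\log_bx\rfloor+1}}{b-1}$. This is the tail $x\mapsto\Lambda_\rho([x,\infty))$ of a measure $\Lambda_\rho$ on $(0,\infty)$ with $\int(1\wedge x^2)\,\Lambda_\rho(dx)<\infty$. $L_\rho=(L_\rho(t))_{t\ge0}$ is the Lévy process without negative jumps with Laplace exponent $\Psi_\rho(a)=\int_{(0,\infty)}\left(e^{-ax}-1+ax\mathbf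 1_{\{x<1\}}\right)\Lambda_\rho(dx)$, i.e. $\mathbb E[e^{-aL_\rho(t)}]=e^{t\Psi_\rho(a)}$ for $a\ge0$. *)

theory Defs
  imports "HOL-Probability.Probability"
begin

section \<open>Percolation on the complete regular tree\<close>

text \<open>
  Vertices are words over \<open>{0, \<dots>, b - 1}\<close> of length at most \<open>h\<close>: the root is the empty word, the
  children of \<open>v\<close> are the words \<open>v @ [i]\<close>, and the length is the distance from the root.
\<close>

definition reg_tree_verts :: "nat \<Rightarrow> nat \<Rightarrow> nat list set" where
  "reg_tree_verts b h = {v. set v \<subseteq> {..<b} \<and> length v \<le> h}"

definition reg_tree_edges :: "nat \<Rightarrow> nat \<Rightarrow> nat list set set" where
  "reg_tree_edges b h = {{v, v @ [i]} | v i. v \<in> reg_tree_verts b h \<and> length v < h \<and> i < b}"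

definition reg_tree_size :: "nat \<Rightarrow> nat \<Rightarrow> real" where
  "reg_tree_size b h = (real b ^ (h + 1) - 1) / (real b - 1)"

lemma card_reg_tree_verts:
  assumes "b \<ge> 2"
  shows "real (card (reg_tree_verts b h)) = reg_tree_size b h"
proof -
  have "card (reg_tree_verts b h) = (\<Sum>i\<le>h. b ^ i)"
    unfolding reg_tree_verts_def by (subst card_lists_length_le) auto
  also have "real \<dots> = (real b ^ Suc h - 1) / (real b - 1)"
    using assms geometric_sum[of "real b" "Suc h"]
    by (simp add: lessThan_Suc_atMost[symmetric] del: power_Suc sum.lessThan_Suc)
  finally show ?thesis
    by (simp add: reg_tree_size_def)
qed

text \<open>
  A configuration \<open>\<omega>\<close> assigns \<open>True\<close> to the edges that are kept.
\<close>

definition bond_percolation :: "'v set set \<Rightarrow> real \<Rightarrow> ('v set \<Rightarrow> bool) pmf" where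
  "bond_percolation E p = Pi_pmf E False (\<lambda>_. bernoulli_pmf p)"

definition cluster :: "'v set set \<Rightarrow> ('v set \<Rightarrow> bool) \<Rightarrow> 'v \<Rightarrow> 'v set" where
  "cluster E \<omega> v = {w. (v, w) \<in> {(x, y). {x, y} \<in> E \<and> \<omega> {x, y}}\<^sup>*}"

definition root_cluster_size :: "nat \<Rightarrow> nat \<Rightarrow> (nat list set \<Rightarrow> bool) \<Rightarrow> nat" where
  "root_cluster_size b h \<omega> = card (cluster (reg_tree_edges b h) \<omega> [])"


section \<open>Levy processes\<close>

definition cadlag :: "(real \<Rightarrow> real) \<Rightarrow> bool" where
  "cadlag f \<longleftrightarrow> (\<forall>t\<ge>0. continuous (at_right t) f) \<and> (\<forall>t>0. \<exists>l. (f \<longlongrightarrow> l) (at_left t))"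

text \<open>Time is \<open>[0, \<infinity>)\<close>; the values of \<open>L\<close> at negative times are irrelevant.\<close>

definition levy_process :: "'a measure \<Rightarrow> (real \<Rightarrow> 'a \<Rightarrow> real) \<Rightarrow> bool" where
  "levy_process M L \<longleftrightarrow>
     prob_space M \<and>
     (\<forall>t\<ge>0. L t \<in> borel_measurable M) \<and>
     (AE \<omega> in M. L 0 \<omega> = 0) \<and>
     (\<forall>n (t :: nat \<Rightarrow> real). 0 \<le> t 0 \<and> (\<forall>i<n. t i \<le> t (Suc i)) \<longrightarrow>
        prob_space.indep_vars M (\<lambda>_. borel) (\<lambda>i \<omega>. L (t (Suc i)) \<omega> - L (t i) \<omega>) {..<n}) \<and>
     (\<forall>s\<ge>0. \<forall>t\<ge>0. distr M borel (\<lambda>\<omega>. L (s + t) \<omega> - L s \<omega>) = distr M borel (L t)) \<and>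
     (AE \<omega> in M. cadlag (\<lambda>t. L t \<omega>))"

definition no_negative_jumps :: "'a measure \<Rightarrow> (real \<Rightarrow> 'a \<Rightarrow> real) \<Rightarrow> bool" where
  "no_negative_jumps M L \<longleftrightarrow>
     (AE \<omega> in M. \<forall>t>0. \<forall>l. ((\<lambda>s. L s \<omega>) \<longlongrightarrow> l) (at_left t) \<longrightarrow> l \<le> L t \<omega>)"

definition has_laplace_exponent ::
    "'a measure \<Rightarrow> (real \<Rightarrow> 'a \<Rightarrow> real) \<Rightarrow> (real \<Rightarrow> real) \<Rightarrow> bool" where
  "has_laplace_exponent M L \<Psi> \<longleftrightarrow>
     (\<forall>t\<ge>0. \<forall>a\<ge>0. integrable M (\<lambda>\<omega>. exp (- a * L t \<omega>)) \<and>
                     (\<integral>\<omega>. exp (- a * L t \<omega>) \<partial>M) = exp (t * \<Psi> a))"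


section \<open>The Levy measure and the Laplace exponent of the limit\<close>

definition Lambda_tail :: "nat \<Rightarrow> real \<Rightarrow> real \<Rightarrow> real" where
  "Lambda_tail b \<rho> x =
     real b powr (- \<rho> + real_of_int \<lfloor>\<rho> - log (real b) x\<rfloor> + 1) / (real b - 1)"

text \<open>
  A measure on \<open>(0, \<infinity>)\<close> is represented by a Borel measure on the real line that does not charge
  \<open>(-\<infinity>, 0]\<close>.
\<close>

definition is_Lambda :: "nat \<Rightarrow> real \<Rightarrow> real measure \<Rightarrow> bool" where
  "is_Lambda b \<rho> \<Lambda> \<longleftrightarrow>
     sets \<Lambda> = sets borel \<and> emeasure \<Lambda> {..0} = 0 \<and>
     (\<forall>x>0. emeasure \<Lambda> {x..} = ennreal (Lambda_tail b \<rho> x))"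

definition Lambda_measure :: "nat \<Rightarrow> real \<Rightarrow> real measure" where
  "Lambda_measure b \<rho> = (THE \<Lambda>. is_Lambda b \<rho> \<Lambda>)"

definition Psi :: "nat \<Rightarrow> real \<Rightarrow> real \<Rightarrow> real" where
  "Psi b \<rho> a =
     (LINT x:{0<..}|Lambda_measure b \<rho>. exp (- a * x) - 1 + a * x * indicator {x. x < 1} x)"


subsection \<open>Existence and uniqueness of the Levy measure\<close>

text \<open>The measure is purely atomic, with mass \<open>b\<^sup>k\<^sup>-\<^sup>\<rho>\<close> at \<open>b\<^sup>\<rho>\<^sup>-\<^sup>k\<close> for every integer \<open>k\<close>.\<close>

definition Lambda_atoms :: "nat \<Rightarrow> real \<Rightarrow> real measure" where
  "Lambda_atoms b \<rho> =
     distr (density (count_space UNIV) (\<lambda>k::int. ennreal (real b powr (real_of_int k - \<rho>)))) borel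
       (\<lambda>k. real b powr (\<rho> - real_of_int k))"

lemma nn_integral_Lambda_atoms:
  assumes [measurable]: "f \<in> borel_measurable borel"
  shows "(\<integral>\<^sup>+ x. f x \<partial>Lambda_atoms b \<rho>) =
         (\<integral>\<^sup>+ k. ennreal (real b powr (real_of_int k - \<rho>)) * f (real b powr (\<rho> - real_of_int k))
            \<partial>count_space UNIV)"
  unfolding Lambda_atoms_def
  by (subst nn_integral_distr) (auto simp: nn_integral_density)

lemma suminf_ennreal_geometric:
  assumes "b \<ge> 2"
  shows "(\<Sum>n. ennreal (real b powr (s - real n))) = ennreal (real b powr (s + 1) / (real b - 1))"
proof -
  have eq: "real b powr (s - real n) = real b powr s * (1 / real b) ^ n" for n
    using assms by (simp add: powr_diff powr_realpow power_divide)
  have "(\<lambda>n. real b powr s * (1 / real b) ^ n) sums (real b powr s * (1 / (1 - 1 / real b)))"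
    using assms by (intro sums_mult geometric_sums) auto
  also have "real b powr s * (1 / (1 - 1 / real b)) = real b powr (s + 1) / (real b - 1)"
    using assms by (simp add: powr_add field_simps)
  finally show ?thesis
    unfolding eq by (intro suminf_ennreal_eq) auto
qed

lemma is_Lambda_atoms:
  assumes "b \<ge> 2"
  shows "is_Lambda b \<rho> (Lambda_atoms b \<rho>)"
proof -
  have pos: "real b powr y > 0" for y
    using assms by simp
  have "emeasure (Lambda_atoms b \<rho>) {..0} = (\<integral>\<^sup>+ x. indicator {..0} x \<partial>Lambda_atoms b \<rho>)"
    by (subst nn_integral_indicator) (auto simp: Lambda_atoms_def)
  also have "\<dots> = 0"
    by (subst nn_integral_Lambda_atoms) (use pos in \<open>auto simp: indicator_def\<close>)
  finally have zero: "emeasure (Lambda_atoms b \<rho>) {..0} = 0" .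
  have "emeasure (Lambda_atoms b \<rho>) {x..} = ennreal (Lambda_tail b \<rho> x)" if x: "x > 0" for x
  proof -
    define m where "m = \<lfloor>\<rho> - log (real b) x\<rfloor>"
    have iff: "x \<le> real b powr (\<rho> - real_of_int k) \<longleftrightarrow> k \<le> m" for k
    proof -
      have "x \<le> real b powr (\<rho> - real_of_int k) \<longleftrightarrow> log (real b) x \<le> \<rho> - real_of_int k"
        using assms x by (subst log_le_iff) auto
      also have "\<dots> \<longleftrightarrow> k \<le> m"
        unfolding m_def by (simp add: le_floor_iff algebra_simps)
      finally show ?thesis .
    qed
    have bij: "bij_betw (\<lambda>n. m - int n) UNIV {..m}"
      by (rule bij_betwI[where g = "\<lambda>k. nat (m - k)"]) auto
    have "emeasure (Lambda_atoms b \<rho>) {x..} = (\<integral>\<^sup>+ y. indicator {x..} y \<partial>Lambda_atoms b \<rho>)"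
      by (subst nn_integral_indicator) (auto simp: Lambda_atoms_def)
    also have "\<dots> = (\<integral>\<^sup>+ k. ennreal (real b powr (real_of_int k - \<rho>)) * indicator {..m} k
                       \<partial>count_space UNIV)"
      by (subst nn_integral_Lambda_atoms) (auto simp: iff indicator_def intro!: nn_integral_cong)
    also have "\<dots> = (\<integral>\<^sup>+ k. ennreal (real b powr (real_of_int k - \<rho>)) \<partial>count_space {..m})"
      by (subst nn_integral_count_space_indicator) auto
    also have "\<dots> = (\<integral>\<^sup>+ n. ennreal (real b powr (real_of_int (m - int n) - \<rho>))
                       \<partial>count_space UNIV)"
      by (rule nn_integral_bij_count_space[OF bij, symmetric])
    also have "\<dots> = (\<Sum>n. ennreal (real b powr ((real_of_int m - \<rho>) - real n)))"
      by (subst nn_integral_count_space_nat) (simp add: algebra_simps)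
    also have "\<dots> = ennreal (Lambda_tail b \<rho> x)"
      unfolding suminf_ennreal_geometric[OF assms] Lambda_tail_def m_def
      by (simp add: algebra_simps)
    finally show ?thesis .
  qed
  with zero show ?thesis
    by (auto simp: is_Lambda_def Lambda_atoms_def)
qed

lemma is_Lambda_unique:
  assumes M: "is_Lambda b \<rho> M" and N: "is_Lambda b \<rho> N"
  shows "M = N"
proof -
  define E :: "real set set" where
    "E = {A \<in> sets borel. A \<subseteq> {..0}} \<union> {{x..} | x. 0 < x}"
  define A :: "nat \<Rightarrow> real set" where
    "A = (\<lambda>n. case n of 0 \<Rightarrow> {..0} | Suc n \<Rightarrow> {1 / real (Suc n)..})"
  have setsM: "sets M = sets borel" and setsN: "sets N = sets borel"
    using M N by (auto simp: is_Lambda_def)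
  have "Int_stable E"
  proof (rule Int_stableI)
    fix X Y assume XY: "X \<in> E" "Y \<in> E"
    then have borel: "X \<inter> Y \<in> sets borel"
      by (auto simp: E_def)
    show "X \<inter> Y \<in> E"
    proof (cases "X \<subseteq> {..0} \<or> Y \<subseteq> {..0}")
      case True
      then show ?thesis using borel by (auto simp: E_def)
    next
      case False
      then obtain x y where "X = {x..}" "Y = {y..}" "0 < x" "0 < y"
        using XY by (auto simp: E_def)
      then show ?thesis
        by (auto simp: E_def intro!: exI[of _ "max x y"])
    qed
  qed
  moreover have eq: "emeasure M X = emeasure N X" if "X \<in> E" for X
  proof -
    have "emeasure K X = 0" if "is_Lambda b \<rho> K" "X \<in> sets borel" "X \<subseteq> {..0}" for K
      using that emeasure_mono[of X "{..0}" K] by (auto simp: is_Lambda_def)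
    then show ?thesis
      using \<open>X \<in> E\<close> M N by (auto simp: E_def is_Lambda_def)
  qed
  moreover have gen: "sets borel = sigma_sets UNIV E"
  proof
    have "sets borel = sigma_sets UNIV (range (\<lambda>x::real. {x..}))"
      by (subst borel_Ici) simp
    also have "\<dots> \<subseteq> sigma_sets UNIV E"
    proof (rule sigma_sets_mono, safe)
      fix x :: real
      show "{x..} \<in> sigma_sets UNIV E"
      proof (cases "x > 0")
        case True
        then show ?thesis by (auto simp: E_def)
      next
        case False
        have "{..0} \<in> sigma_sets UNIV E"
          by (auto simp: E_def)
        then have "UNIV - {..0} \<in> sigma_sets UNIV E"
          by (rule sigma_sets.Compl)
        moreover have "{x..0} \<in> sigma_sets UNIV E"
          by (auto simp: E_def)
        ultimately have "{x..0} \<union> (UNIV - {..0}) \<in> sigma_sets UNIV E"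
          by (intro sigma_sets_Un)
        also have "{x..0} \<union> (UNIV - {..0}) = {x..}"
          using False by auto
        finally show ?thesis .
      qed
    qed
    finally show "sets borel \<subseteq> sigma_sets UNIV E" .
    have "sigma_sets (space borel) E \<subseteq> sets borel"
      by (rule sets.sigma_sets_subset) (auto simp: E_def)
    then show "sigma_sets UNIV E \<subseteq> sets borel"
      by simp
  qed
  moreover have "range A \<subseteq> E"
  proof safe
    fix n show "A n \<in> E"
      by (cases n) (auto simp: A_def E_def intro!: exI[of _ "1 / real n"])
  qed
  moreover have "(\<Union>n. A n) = UNIV"
  proof (safe; simp)
    fix x :: real
    show "\<exists>n. x \<in> A n"
    proof (cases "x \<le> 0")
      case True
      then show ?thesis by (intro exI[of _ 0]) (auto simp: A_def)
    next
      case False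
      then obtain n where "inverse (real (Suc n)) < x"
        using reals_Archimedean[of x] by auto
      then show ?thesis
        by (intro exI[of _ "Suc n"]) (auto simp: A_def inverse_eq_divide)
    qed
  qed
  moreover have "emeasure M (A n) \<noteq> \<infinity>" for n
    using M by (cases n) (auto simp: A_def is_Lambda_def)
  ultimately show ?thesis
    by (intro measure_eqI_generator_eq[of E UNIV M N A]) (auto simp: setsM setsN)
qed

lemma Lambda_measure_eq:
  assumes "b \<ge> 2"
  shows "Lambda_measure b \<rho> = Lambda_atoms b \<rho>"
  unfolding Lambda_measure_def
  using is_Lambda_atoms[OF assms] is_Lambda_unique by blast

lemma is_Lambda_measure:
  assumes "b \<ge> 2"
  shows "is_Lambda b \<rho> (Lambda_measure b \<rho>)"
  using is_Lambda_atoms[OF assms] by (simp add: Lambda_measure_eq[OF assms])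

lemma Lambda_measure_levy:
  assumes "b \<ge> 2"
  shows "(\<integral>\<^sup>+ x. ennreal (min 1 (x\<^sup>2)) \<partial>Lambda_measure b \<rho>) < \<infinity>"
proof -
  let ?t = "\<lambda>k::int. ennreal (real b powr (real_of_int k - \<rho>)) *
                     ennreal (min 1 ((real b powr (\<rho> - real_of_int k))\<^sup>2))"
  let ?u = "\<lambda>n::nat. ennreal (real b powr (\<rho> - real n))"
  let ?v = "\<lambda>n::nat. ennreal (real b powr (- \<rho> - real n))"
  have t1: "?t k \<le> ennreal (real b powr (real_of_int k - \<rho>))" for k
    using mult_left_mono[of "ennreal (min 1 ((real b powr (\<rho> - real_of_int k))\<^sup>2))" 1
        "ennreal (real b powr (real_of_int k - \<rho>))"] by (simp add: ennreal_le_1)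
  have t2: "?t k \<le> ennreal (real b powr (\<rho> - real_of_int k))" for k
  proof -
    have "?t k \<le> ennreal (real b powr (real_of_int k - \<rho>)) *
                 ennreal ((real b powr (\<rho> - real_of_int k))\<^sup>2)"
      by (intro mult_left_mono ennreal_leI) auto
    also have "\<dots> = ennreal (real b powr (real_of_int k - \<rho>) *
                            (real b powr (\<rho> - real_of_int k))\<^sup>2)"
      by (simp add: ennreal_mult)
    also have "real b powr (real_of_int k - \<rho>) * (real b powr (\<rho> - real_of_int k))\<^sup>2 =
               real b powr (\<rho> - real_of_int k)"
      by (simp add: power2_eq_square powr_add[symmetric])
    finally show ?thesis .
  qed
  have bij1: "bij_betw int UNIV {0..}"
    by (rule bij_betwI[where g = nat]) auto
  have bij2: "bij_betw (\<lambda>n. - int n) UNIV {..0}"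
    by (rule bij_betwI[where g = "\<lambda>k. nat (- k)"]) auto
  have "(\<integral>\<^sup>+ x. ennreal (min 1 (x\<^sup>2)) \<partial>Lambda_measure b \<rho>) = (\<integral>\<^sup>+ k. ?t k \<partial>count_space UNIV)"
    unfolding Lambda_measure_eq[OF assms] by (subst nn_integral_Lambda_atoms) auto
  also have "\<dots> \<le> (\<integral>\<^sup>+ k. ?t k * indicator {0..} k + ?t k * indicator {..0} k \<partial>count_space UNIV)"
    by (intro nn_integral_mono) (auto simp: indicator_def)
  also have "\<dots> = (\<integral>\<^sup>+ k. ?t k \<partial>count_space {0..}) + (\<integral>\<^sup>+ k. ?t k \<partial>count_space {..0})"
    by (subst nn_integral_add) (auto simp: nn_integral_count_space_indicator)
  also have "(\<integral>\<^sup>+ k. ?t k \<partial>count_space {0..}) = (\<integral>\<^sup>+ n. ?t (int n) \<partial>count_space UNIV)"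
    by (rule nn_integral_bij_count_space[OF bij1, symmetric])
  also have "(\<integral>\<^sup>+ k. ?t k \<partial>count_space {..0}) = (\<integral>\<^sup>+ n. ?t (- int n) \<partial>count_space UNIV)"
    by (rule nn_integral_bij_count_space[OF bij2, symmetric])
  also have "(\<integral>\<^sup>+ n. ?t (int n) \<partial>count_space UNIV) \<le> (\<integral>\<^sup>+ n. ?u n \<partial>count_space UNIV)"
    by (intro nn_integral_mono order_trans[OF t2]) simp
  also have "(\<integral>\<^sup>+ n. ?t (- int n) \<partial>count_space UNIV) \<le> (\<integral>\<^sup>+ n. ?v n \<partial>count_space UNIV)"
  proof (rule nn_integral_mono)
    fix n :: nat
    have "real_of_int (- int n) - \<rho> = - \<rho> - real n"
      by simp
    then show "?t (- int n) \<le> ?v n"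
      using t1[of "- int n"] by metis
  qed
  also have "(\<integral>\<^sup>+ n. ?u n \<partial>count_space UNIV) + (\<integral>\<^sup>+ n. ?v n \<partial>count_space UNIV) < \<infinity>"
    unfolding nn_integral_count_space_nat suminf_ennreal_geometric[OF assms] by simp
  finally show ?thesis
    by (simp add: add_mono)
qed

end

theory Submission
  imports Defs "HOL-Complex_Analysis.Complex_Analysis" "HOL-Real_Asymp.Real_Asymp"
begin

text \<open>
  The proof computes the moment generating function of the rescaled cluster size at every \<open>a > 0\<close>
  and shows that it converges to that of the limit.

  Removing the last layer of edges, conditionally on the rest, shows that the logarithm \<open>u_h\<close> of
  \<open>E exp (s G_h)\<close> arises by iterating \<open>u \<mapsto> s + b ln (1 - p + p e^u)\<close> from \<open>u_0 = s\<close>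
  (\<open>mgf_root_cluster_size\<close>). For \<open>q = 1 - p\<close> close to \<open>0\<close>, the function \<open>ln (1 - p + p e^u)\<close> is
  \<open>p u + q f(u)\<close> up to \<open>O(q^2)\<close>, where \<open>f(u) = e^(-u) - 1 + u\<close>. Solving the linear part of the
  recursion gives \<open>u_h\<close> as \<open>s E G_h\<close> plus the sum over \<open>l < h\<close> of \<open>q b^(h-l) f(u_l)\<close>, up to small
  errors. On the scale \<open>s = a h / n_h\<close> a subtree that hangs \<open>i\<close> levels below the root has \<open>u_(h-i)\<close>
  close to \<open>\<alpha> h b^(-i)\<close> with \<open>\<alpha> = a e^(-c)\<close>, and \<open>q\<close> is close to \<open>c / h\<close> (\<open>cumulant_expansion\<close>).

  It remains to study \<open>(c / h) \<Sum> b^i f(\<alpha> h b^(-i))\<close>. The term of index \<open>i\<close> is the contribution to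
  \<open>c \<Psi>_\<rho>(\<alpha>)\<close> of a jump of size \<open>h b^(-i)\<close>, occurring at rate \<open>b^i / h\<close>: it describes the loss of a
  subtree at distance \<open>i\<close> from the root. Writing \<open>h = b^(m+r)\<close> with \<open>m\<close> an integer and \<open>0 \<le> r < 1\<close>,
  these sizes belong to the geometric progression \<open>b^(r-k)\<close> of the atoms of \<open>\<Lambda>_r\<close>. The function \<open>f\<close>
  compensates all jumps, \<open>\<Psi>_\<rho>\<close> only those below \<open>1\<close>; the difference is \<open>c \<alpha>\<close> for each of the \<open>m\<close>
  large ones, hence the centring by \<open>log_b h = m + r\<close> and the term \<open>c \<rho>\<close> of the limit
  (\<open>compensated_sum_limit\<close>). The term \<open>c / (b - 1)\<close> comes from the expansion of \<open>E G_h / n_h\<close> to the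
  order \<open>1 / h\<close> (\<open>mean_size_limit\<close>).

  Since the Laplace transform of the Levy process is known on the half-line only, the passage to
  weak convergence uses a continuity theorem for one-sided transforms (\<open>weak_conv_of_mgf\<close>), which is
  obtained by analytic continuation to the right half-plane.
\<close>

section \<open>The root cluster, level by level\<close>

definition level :: "nat \<Rightarrow> nat \<Rightarrow> nat list set" where
  "level b k = {v. set v \<subseteq> {..<b} \<and> length v = k}"

text \<open>
  A vertex is joined to the root by exactly one path, whose edges are the pairs of consecutive
  prefixes of the word.
\<close>

definition open_path :: "(nat list set \<Rightarrow> bool) \<Rightarrow> nat list \<Rightarrow> bool" where
  "open_path \<omega> v \<longleftrightarrow> (\<forall>k<length v. \<omega> {take k v, take (Suc k) v})"

definition open_level :: "nat \<Rightarrow> nat \<Rightarrow> (nat list set \<Rightarrow> bool) \<Rightarrow> nat list set" where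
  "open_level b k \<omega> = {v \<in> level b k. open_path \<omega> v}"

lemma open_path_Nil [simp]: "open_path \<omega> []"
  by (simp add: open_path_def)

lemma open_path_snoc [simp]: "open_path \<omega> (v @ [i]) \<longleftrightarrow> open_path \<omega> v \<and> \<omega> {v, v @ [i]}"
  unfolding open_path_def by (auto simp: less_Suc_eq)

lemma finite_level [simp, intro]: "finite (level b k)"
  unfolding level_def by (rule finite_lists_length_eq) simp

lemma finite_open_level [simp, intro]: "finite (open_level b k \<omega>)"
  unfolding open_level_def by simp

lemma cluster_root_eq:
  "cluster (reg_tree_edges b h) \<omega> [] = (\<Union>k\<le>h. open_level b k \<omega>)"
proof (intro equalityI subsetI)
  fix w assume "w \<in> cluster (reg_tree_edges b h) \<omega> []"
  then have "([], w) \<in> {(x, y). {x, y} \<in> reg_tree_edges b h \<and> \<omega> {x, y}}\<^sup>*"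
    by (simp add: cluster_def)
  then show "w \<in> (\<Union>k\<le>h. open_level b k \<omega>)"
  proof (induction rule: rtrancl_induct)
    case base
    then show ?case by (auto simp: open_level_def level_def)
  next
    case (step x y)
    then have open_xy: "\<omega> {x, y}" by simp
    from step obtain v i where v: "{x, y} = {v, v @ [i]}" "set v \<subseteq> {..<b}" "length v < h" "i < b"
      by (auto simp: reg_tree_edges_def reg_tree_verts_def)
    then consider "x = v" "y = v @ [i]" | "x = v @ [i]" "y = v"
      by (auto simp: doubleton_eq_iff)
    then show ?case
      using step.IH open_xy v by cases (auto simp: open_level_def level_def)
  qed
next
  fix w assume "w \<in> (\<Union>k\<le>h. open_level b k \<omega>)"
  then have "set w \<subseteq> {..<b}" "length w \<le> h" "open_path \<omega> w"
    by (auto simp: open_level_def level_def)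
  then have "([], w) \<in> {(x, y). {x, y} \<in> reg_tree_edges b h \<and> \<omega> {x, y}}\<^sup>*"
  proof (induction w rule: rev_induct)
    case (snoc i v)
    then have "([], v) \<in> {(x, y). {x, y} \<in> reg_tree_edges b h \<and> \<omega> {x, y}}\<^sup>*"
      by simp
    moreover have "{v, v @ [i]} \<in> reg_tree_edges b h"
      using snoc.prems unfolding reg_tree_edges_def reg_tree_verts_def
      by (intro CollectI exI[of _ v] exI[of _ i]) auto
    ultimately show ?case
      using snoc.prems by (auto intro: rtrancl_into_rtrancl)
  qed auto
  then show "w \<in> cluster (reg_tree_edges b h) \<omega> []"
    by (simp add: cluster_def)
qed

lemma root_cluster_size_eq: "root_cluster_size b h \<omega> = (\<Sum>k\<le>h. card (open_level b k \<omega>))"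
  unfolding root_cluster_size_def cluster_root_eq
  by (rule card_UN_disjoint) (simp, simp, auto simp: open_level_def level_def)

definition layer_edges :: "nat \<Rightarrow> nat \<Rightarrow> nat list set set" where
  "layer_edges b k = (\<lambda>(v, i). {v, v @ [i]}) ` (level b k \<times> {..<b})"

text \<open>
  The lengths of the words orient an edge, so an edge determines its parent and its child.
\<close>

lemma edge_eq_iff: "{v, v @ [i]} = {w, w @ [j]} \<longleftrightarrow> v = w \<and> i = j"
proof
  assume "{v, v @ [i]} = {w, w @ [j]}"
  then consider "v = w" "v @ [i] = w @ [j]" | "v = w @ [j]" "v @ [i] = w"
    by (metis doubleton_eq_iff)
  then show "v = w \<and> i = j"
  proof cases
    case 2
    then have "length v = length (w @ [j])" "length (v @ [i]) = length w"
      by (simp_all only:)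
    then show ?thesis by simp
  qed auto
qed auto

lemma inj_edge: "inj (\<lambda>(v, i). {v, v @ [i :: nat]})"
  unfolding inj_def split_paired_All prod.case edge_eq_iff by simp

lemma layer_edges_iff: "x \<in> layer_edges b k \<longleftrightarrow> (\<exists>v i. x = {v, v @ [i]} \<and> v \<in> level b k \<and> i < b)"
  unfolding layer_edges_def image_iff Bex_def split_paired_Ex prod.case mem_Sigma_iff lessThan_iff
  by (simp only: conj_commute)

lemma reg_tree_edges_eq: "reg_tree_edges b h = (\<Union>k<h. layer_edges b k)"
proof -
  have *: "{e v i | v i. set v \<subseteq> {..<b} \<and> length v \<le> h \<and> length v < h \<and> i < b} =
          (\<Union>k<h. {e v i | v i. (set v \<subseteq> {..<b} \<and> length v = k) \<and> i < b})" (is "?L = ?R")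
    for e :: "nat list \<Rightarrow> nat \<Rightarrow> nat list set"
  proof (intro equalityI subsetI)
    fix x assume "x \<in> ?L"
    then obtain v i where "x = e v i" "set v \<subseteq> {..<b}" "length v < h" "i < b" by blast
    then show "x \<in> ?R" by blast
  next
    fix x assume "x \<in> ?R"
    then obtain v i where "x = e v i" "set v \<subseteq> {..<b}" "length v < h" "i < b" by blast
    then show "x \<in> ?L" using less_imp_le[of "length v" h] by blast
  qed
  have **: "layer_edges b k = {{v, v @ [i]} | v i. (set v \<subseteq> {..<b} \<and> length v = k) \<and> i < b}" for k
    by (rule set_eqI) (simp add: layer_edges_iff level_def)
  have "reg_tree_edges b h =
          {{v, v @ [i]} | v i. set v \<subseteq> {..<b} \<and> length v \<le> h \<and> length v < h \<and> i < b}"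
    unfolding reg_tree_edges_def reg_tree_verts_def mem_Collect_eq conj_assoc ..
  then show ?thesis
    unfolding ** by (rule trans) (rule *)
qed

lemma reg_tree_edges_0 [simp]: "reg_tree_edges b 0 = {}"
  by (simp add: reg_tree_edges_eq)

lemma reg_tree_edges_Suc: "reg_tree_edges b (Suc h) = reg_tree_edges b h \<union> layer_edges b h"
  by (simp add: reg_tree_edges_eq lessThan_Suc Un_commute)

lemma reg_tree_edges_layer_disjoint: "reg_tree_edges b h \<inter> layer_edges b h = {}"
  by (auto simp: reg_tree_edges_eq layer_edges_iff level_def edge_eq_iff)

lemma finite_layer_edges [simp, intro]: "finite (layer_edges b h)"
  by (simp add: layer_edges_def)

lemma finite_reg_tree_edges [simp, intro]: "finite (reg_tree_edges b h)"
  by (induction h) (auto simp: reg_tree_edges_Suc)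

lemma open_level_cong:
  assumes "\<And>e. e \<in> reg_tree_edges b h \<Longrightarrow> \<omega> e = \<omega>' e" and "k \<le> h"
  shows "open_level b k \<omega> = open_level b k \<omega>'"
proof -
  have "open_path \<omega> v = open_path \<omega>' v" if "v \<in> level b k" for v
    unfolding open_path_def
  proof (intro all_cong assms(1))
    fix j assume "j < length v"
    then have "take (Suc j) v = take j v @ [v ! j]" and nth: "v ! j \<in> set v"
      by (auto simp: take_Suc_conv_app_nth)
    moreover have "v ! j < b" using nth that unfolding level_def by blast
    moreover have "set v \<subseteq> {..<b}" "length v \<le> h" "set (take j v) \<subseteq> set v"
      using that assms(2) set_take_subset[of j v] by (auto simp: level_def)
    ultimately show "{take j v, take (Suc j) v} \<in> reg_tree_edges b h"
      using \<open>j < length v\<close> unfolding reg_tree_edges_def reg_tree_verts_def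
      by (intro CollectI exI[of _ "take j v"] exI[of _ "v ! j"]) auto
  qed
  then show ?thesis by (auto simp: open_level_def)
qed

lemma card_open_level_Suc:
  "card (open_level b (Suc k) \<omega>) = (\<Sum>v\<in>open_level b k \<omega>. \<Sum>i<b. if \<omega> {v, v @ [i]} then 1 else 0)"
proof -
  have "open_level b (Suc k) \<omega> =
          (\<lambda>(v, i). v @ [i]) ` (SIGMA v:open_level b k \<omega>. {i\<in>{..<b}. \<omega> {v, v @ [i]}})" (is "_ = _ ` ?P")
  proof (intro equalityI subsetI)
    fix w assume "w \<in> open_level b (Suc k) \<omega>"
    then obtain v i where "w = v @ [i]" "(v, i) \<in> ?P"
      by (cases w rule: rev_cases) (auto simp: open_level_def level_def)
    then show "w \<in> (\<lambda>(v, i). v @ [i]) ` ?P" by force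
  qed (auto simp: open_level_def level_def)
  moreover have "inj_on (\<lambda>(v, i). v @ [i]) ?P"
    by (auto simp: inj_on_def)
  ultimately have "card (open_level b (Suc k) \<omega>) = card ?P"
    by (simp add: card_image)
  also have "\<dots> = (\<Sum>v\<in>open_level b k \<omega>. card {i\<in>{..<b}. \<omega> {v, v @ [i]}})"
    by (simp add: card_SigmaI)
  also have "\<dots> = (\<Sum>v\<in>open_level b k \<omega>. \<Sum>i<b. if \<omega> {v, v @ [i]} then 1 else 0)"
    by (simp add: sum.If_cases Int_def conj_commute)
  finally show ?thesis .
qed

abbreviation (input) tree_percolation :: "nat \<Rightarrow> real \<Rightarrow> nat \<Rightarrow> (nat list set \<Rightarrow> bool) pmf" where
  "tree_percolation b p h \<equiv> bond_percolation (reg_tree_edges b h) p"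

lemma finite_set_tree_percolation [simp, intro]: "finite (set_pmf (tree_percolation b p h))"
  unfolding bond_percolation_def by (rule finite_subset[OF set_Pi_pmf_subset']) (auto intro!: finite_PiE_dflt)

lemma integrable_tree_percolation [simp, intro]: "integrable (measure_pmf (tree_percolation b p h)) (f :: _ \<Rightarrow> real)"
  by (rule integrable_measure_pmf_finite) simp

text \<open>
  Given the open vertices at distance \<open>h\<close>, the number of open vertices at distance \<open>h + 1\<close> is a sum
  of independent Bernoulli variables, one for each edge that leaves the former; the expectation is
  the generating function of a binomial law. The edges below the other vertices contribute the
  factor 1.
\<close>

lemma expectation_last_layer:
  fixes \<omega> :: "nat list set \<Rightarrow> bool" and y :: real
  assumes p: "0 \<le> p" "p \<le> 1" and y: "y > 0"
  shows "measure_pmf.expectation (bond_percolation (layer_edges b h) p)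
           (\<lambda>\<eta>. y ^ (\<Sum>v\<in>open_level b h \<omega>. \<Sum>i<b. if \<eta> {v, v @ [i]} then 1 else 0)) =
         (1 - p + p * y) ^ (b * card (open_level b h \<omega>))"
proof -
  define e where "e = (\<lambda>(v, i). {v, v @ [i :: nat]})"
  define f where "f x t = (if x \<in> e ` (open_level b h \<omega> \<times> {..<b}) \<and> t then y else 1)" for x t
  have inj: "inj_on e A" for A
    using inj_edge unfolding e_def by (rule inj_on_subset) simp
  have layer: "layer_edges b h = e ` (level b h \<times> {..<b})"
    by (simp add: layer_edges_def e_def)
  have sub: "open_level b h \<omega> \<subseteq> level b h" by (auto simp: open_level_def)
  have restr: "(\<Prod>x\<in>e ` (open_level b h \<omega> \<times> {..<b}). g x) = (\<Prod>x\<in>layer_edges b h. g x)"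
    if "\<And>x. x \<notin> e ` (open_level b h \<omega> \<times> {..<b}) \<Longrightarrow> g x = 1" for g :: "_ \<Rightarrow> real"
    by (rule prod.mono_neutral_left) (use sub that in \<open>auto simp: layer\<close>)
  have "y ^ (\<Sum>v\<in>open_level b h \<omega>. \<Sum>i<b. if \<eta> {v, v @ [i]} then 1 else 0) =
          (\<Prod>x\<in>layer_edges b h. f x (\<eta> x))" for \<eta>
  proof -
    have "y ^ (\<Sum>v\<in>open_level b h \<omega>. \<Sum>i<b. if \<eta> {v, v @ [i]} then 1 else 0) =
            (\<Prod>z\<in>open_level b h \<omega> \<times> {..<b}. if \<eta> (e z) then y else 1)"
      unfolding power_sum prod.cartesian_product by (auto intro!: prod.cong simp: e_def)
    also have "\<dots> = (\<Prod>x\<in>e ` (open_level b h \<omega> \<times> {..<b}). f x (\<eta> x))"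
      by (subst prod.reindex[OF inj]) (auto simp: f_def intro!: prod.cong)
    also have "\<dots> = (\<Prod>x\<in>layer_edges b h. f x (\<eta> x))"
      by (rule restr) (auto simp: f_def)
    finally show ?thesis .
  qed
  then have "measure_pmf.expectation (bond_percolation (layer_edges b h) p)
           (\<lambda>\<eta>. y ^ (\<Sum>v\<in>open_level b h \<omega>. \<Sum>i<b. if \<eta> {v, v @ [i]} then 1 else 0)) =
        measure_pmf.expectation (bond_percolation (layer_edges b h) p) (\<lambda>\<eta>. \<Prod>x\<in>layer_edges b h. f x (\<eta> x))"
    by simp
  also have "\<dots> = (\<Prod>x\<in>layer_edges b h. measure_pmf.expectation (bernoulli_pmf p) (f x))"
    unfolding bond_percolation_def
    by (rule expectation_prod_Pi_pmf) (use y in \<open>auto simp: f_def integrable_measure_pmf_finite\<close>)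
  also have "\<dots> = (\<Prod>x\<in>e ` (open_level b h \<omega> \<times> {..<b}). measure_pmf.expectation (bernoulli_pmf p) (f x))"
    by (rule restr[symmetric]) (use p in \<open>auto simp: f_def\<close>)
  also have "\<dots> = (\<Prod>x\<in>e ` (open_level b h \<omega> \<times> {..<b}). 1 - p + p * y)"
    by (rule prod.cong) (use p in \<open>auto simp: f_def\<close>)
  also have "\<dots> = (1 - p + p * y) ^ (b * card (open_level b h \<omega>))"
    by (simp add: card_image[OF inj] card_cartesian_product mult.commute)
  finally show ?thesis .
qed

text \<open>
  Percolation on the tree of height \<open>h + 1\<close> is percolation on the tree of height \<open>h\<close> together with
  an independent percolation on the last layer of edges.
\<close>

lemma expectation_tree_percolation_Suc:
  fixes F :: "(nat list set \<Rightarrow> bool) \<Rightarrow> real"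
  shows "measure_pmf.expectation (tree_percolation b p (Suc h)) F =
     measure_pmf.expectation (tree_percolation b p h) (\<lambda>\<omega>.
       measure_pmf.expectation (bond_percolation (layer_edges b h) p)
         (\<lambda>\<eta>. F (\<lambda>x. if x \<in> reg_tree_edges b h then \<omega> x else \<eta> x)))"
proof -
  have fin: "finite (set_pmf (bond_percolation (layer_edges b h) p))"
    unfolding bond_percolation_def by (rule finite_subset[OF set_Pi_pmf_subset']) (auto intro!: finite_PiE_dflt)
  have "tree_percolation b p (Suc h) = map_pmf (\<lambda>(\<omega>, \<eta>) x. if x \<in> reg_tree_edges b h then \<omega> x else \<eta> x)
          (pair_pmf (tree_percolation b p h) (bond_percolation (layer_edges b h) p))"
    unfolding reg_tree_edges_Suc bond_percolation_def
    by (rule Pi_pmf_union) (auto simp: reg_tree_edges_layer_disjoint)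
  also have "\<dots> = tree_percolation b p h \<bind> (\<lambda>\<omega>. map_pmf (\<lambda>\<eta> x. if x \<in> reg_tree_edges b h then \<omega> x else \<eta> x)
          (bond_percolation (layer_edges b h) p))"
    by (simp add: pair_pmf_def map_bind_pmf map_pmf_def bind_assoc_pmf bind_return_pmf)
  finally have eq: "tree_percolation b p (Suc h) = \<dots>" .
  have "measure_pmf.expectation (tree_percolation b p (Suc h)) F = (\<Sum>\<omega>\<in>set_pmf (tree_percolation b p h). pmf (tree_percolation b p h) \<omega> *\<^sub>R
          measure_pmf.expectation (map_pmf (\<lambda>\<eta> x. if x \<in> reg_tree_edges b h then \<omega> x else \<eta> x)
            (bond_percolation (layer_edges b h) p)) F)"
    unfolding eq by (rule pmf_expectation_bind) (auto simp: fin)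
  also have "\<dots> = measure_pmf.expectation (tree_percolation b p h) (\<lambda>\<omega>.
          measure_pmf.expectation (map_pmf (\<lambda>\<eta> x. if x \<in> reg_tree_edges b h then \<omega> x else \<eta> x)
            (bond_percolation (layer_edges b h) p)) F)"
    by (rule integral_measure_pmf[symmetric]) auto
  finally show ?thesis by simp
qed

text \<open>
  By \<open>mgf_root_cluster_size\<close> below, this is the logarithm of the moment generating function at \<open>s\<close>
  of the size of the root cluster of a tree of height \<open>j\<close>: a vertex contributes \<open>s\<close>, and each of its
  \<open>b\<close> children is cut off with probability \<open>1 - p\<close>.
\<close>
fun cumulant :: "nat \<Rightarrow> real \<Rightarrow> real \<Rightarrow> nat \<Rightarrow> real" where
  "cumulant b p s 0 = s"
| "cumulant b p s (Suc j) = s + real b * ln (1 - p + p * exp (cumulant b p s j))"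

text \<open>
  Integrating out the last layer of edges replaces the weight \<open>u\<close> of an open vertex at the lowest
  level by \<open>s + b ln (1 - p + p e^u)\<close> one level higher, which is one step of the recursion for
  \<open>cumulant\<close>. The induction therefore has to carry an arbitrary number \<open>j\<close> of steps that are already
  done. Only the independence of single edges enters.
\<close>

lemma expectation_levels:
  assumes p: "0 < p" "p \<le> 1"
  shows "measure_pmf.expectation (tree_percolation b p h)
     (\<lambda>\<omega>. exp (s * (\<Sum>k<h. real (card (open_level b k \<omega>))) + cumulant b p s j * real (card (open_level b h \<omega>))))
     = exp (cumulant b p s (h + j))"
proof (induction h arbitrary: j)
  case 0
  have "open_level b 0 \<omega> = {[]}" for \<omega>
    by (auto simp: open_level_def level_def)
  then show ?case by simp
next
  case (Suc h)
  define u where "u = cumulant b p s j"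
  have pos: "1 - p + p * exp u > 0"
    using p by (intro add_nonneg_pos) auto
  let ?J = "\<lambda>\<omega> \<eta> x. if x \<in> reg_tree_edges b h then \<omega> x else \<eta> x"
  have "measure_pmf.expectation (tree_percolation b p (Suc h)) (\<lambda>\<omega>. exp (s * (\<Sum>k<Suc h. real (card (open_level b k \<omega>))) +
           u * real (card (open_level b (Suc h) \<omega>)))) =
        measure_pmf.expectation (tree_percolation b p h) (\<lambda>\<omega>. exp (s * (\<Sum>k<h. real (card (open_level b k \<omega>))) +
           cumulant b p s (Suc j) * real (card (open_level b h \<omega>))))"
    unfolding expectation_tree_percolation_Suc
  proof (rule Bochner_Integration.integral_cong[OF refl])
    fix \<omega> :: "nat list set \<Rightarrow> bool"
    have lev: "open_level b k (?J \<omega> \<eta>) = open_level b k \<omega>" if "k \<le> h" for k \<eta>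
      by (rule open_level_cong[OF _ that]) simp
    have last: "card (open_level b (Suc h) (?J \<omega> \<eta>)) =
        (\<Sum>v\<in>open_level b h \<omega>. \<Sum>i<b. if \<eta> {v, v @ [i]} then 1 else 0)" for \<eta>
    proof -
      have "{v, v @ [i]} \<notin> reg_tree_edges b h" if "v \<in> open_level b h \<omega>" "i < b" for v i
        using that reg_tree_edges_layer_disjoint[of b h]
        by (auto simp: layer_edges_def open_level_def)
      then show ?thesis
        unfolding card_open_level_Suc lev[OF order_refl] by (intro sum.cong) auto
    qed
    let ?S = "s * (\<Sum>k<Suc h. real (card (open_level b k \<omega>)))"
    have "measure_pmf.expectation (bond_percolation (layer_edges b h) p)
         (\<lambda>\<eta>. exp (s * (\<Sum>k<Suc h. real (card (open_level b k (?J \<omega> \<eta>)))) +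
           u * real (card (open_level b (Suc h) (?J \<omega> \<eta>))))) =
       measure_pmf.expectation (bond_percolation (layer_edges b h) p)
         (\<lambda>\<eta>. exp ?S * exp u ^ (\<Sum>v\<in>open_level b h \<omega>. \<Sum>i<b. if \<eta> {v, v @ [i]} then 1 else 0))"
      unfolding last by (simp add: lev exp_add exp_of_nat2_mult del: of_nat_sum)
    also have "\<dots> = exp ?S * (1 - p + p * exp u) ^ (b * card (open_level b h \<omega>))"
      using expectation_last_layer[of p "exp u" b h \<omega>] p by simp
    also have "(1 - p + p * exp u) ^ (b * card (open_level b h \<omega>)) =
        exp (real b * ln (1 - p + p * exp u) * real (card (open_level b h \<omega>)))"
      using pos by (simp add: exp_of_nat2_mult exp_of_nat_mult power_mult)
    finally show "measure_pmf.expectation (bond_percolation (layer_edges b h) p)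
         (\<lambda>\<eta>. exp (s * (\<Sum>k<Suc h. real (card (open_level b k (?J \<omega> \<eta>)))) +
           u * real (card (open_level b (Suc h) (?J \<omega> \<eta>))))) =
        exp (s * (\<Sum>k<h. real (card (open_level b k \<omega>))) +
           cumulant b p s (Suc j) * real (card (open_level b h \<omega>)))"
      by (simp add: u_def algebra_simps flip: exp_add)
  qed
  also have "\<dots> = exp (cumulant b p s (Suc h + j))"
    using Suc.IH[of "Suc j"] by simp
  finally show ?case by (simp add: u_def)
qed

lemma mgf_root_cluster_size:
  assumes "0 < p" "p \<le> 1"
  shows "measure_pmf.expectation (tree_percolation b p h) (\<lambda>\<omega>. exp (s * real (root_cluster_size b h \<omega>))) =
         exp (cumulant b p s h)"
  using expectation_levels[OF assms, of b h s 0]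
  by (simp add: root_cluster_size_eq algebra_simps flip: lessThan_Suc_atMost)


section \<open>Weak convergence from one-sided Laplace transforms\<close>

text \<open>
  Vitali's theorem. By Montel's theorem every subsequence has a locally uniformly convergent
  subsequence; its limit agrees with \<open>G\<close> on a set with a limit point, hence everywhere.
\<close>

lemma Vitali_convergence:
  fixes F :: "nat \<Rightarrow> complex \<Rightarrow> complex"
  assumes S: "open S" "connected S"
    and F: "\<And>n. F n holomorphic_on S" and G: "G holomorphic_on S"
    and bdd: "\<And>K. compact K \<Longrightarrow> K \<subseteq> S \<Longrightarrow> \<exists>B. \<forall>n. \<forall>z\<in>K. norm (F n z) \<le> B"
    and U: "U \<subseteq> S" "\<xi> \<in> S" "\<xi> islimpt U" "\<And>z. z \<in> U \<Longrightarrow> (\<lambda>n. F n z) \<longlonglongrightarrow> G z"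
    and z: "z \<in> S"
  shows "(\<lambda>n. F n z) \<longlonglongrightarrow> G z"
proof (rule ccontr)
  assume "\<not> ?thesis"
  then obtain e where e: "e > 0" "\<not> (\<forall>\<^sub>F n in sequentially. dist (F n z) (G z) < e)"
    unfolding tendsto_iff by blast
  then have "infinite {n. \<not> dist (F n z) (G z) < e}"
    by (simp add: cofinite_eq_sequentially[symmetric] eventually_cofinite)
  then obtain r where r: "strict_mono r" "\<And>n::nat. r n \<in> {n. \<not> dist (F n z) (G z) < e}"
    using infinite_enumerate by blast
  obtain g r' where g: "g holomorphic_on S" "strict_mono (r' :: nat \<Rightarrow> nat)"
      "\<And>x. x \<in> S \<Longrightarrow> (\<lambda>n. (F \<circ> r) (r' n) x) \<longlonglongrightarrow> g x"
  proof (rule Montel[OF S(1), of "range F" "F \<circ> r"])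
    show "\<exists>B. \<forall>h\<in>range F. \<forall>z\<in>K. norm (h z) \<le> B" if "compact K" "K \<subseteq> S" for K
      using bdd[OF that] by blast
  qed (use F in auto)
  have "strict_mono (r \<circ> r')"
    using r(1) g(2) by (rule strict_mono_o)
  have eq: "g x = G x" if "x \<in> U" for x
  proof (rule LIMSEQ_unique)
    show "(\<lambda>n. F ((r \<circ> r') n) x) \<longlonglongrightarrow> g x"
      using g(3)[of x] U(1) that by auto
    show "(\<lambda>n. F ((r \<circ> r') n) x) \<longlonglongrightarrow> G x"
      using LIMSEQ_subseq_LIMSEQ[OF U(4)[OF that] \<open>strict_mono (r \<circ> r')\<close>] by (simp add: o_def)
  qed
  have "g z - G z = 0"
    by (rule analytic_continuation[of "\<lambda>z. g z - G z" S U \<xi>])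
       (use S U z eq g(1) G in \<open>auto intro!: holomorphic_intros\<close>)
  then have "(\<lambda>n. F (r (r' n)) z) \<longlonglongrightarrow> G z"
    using g(3)[OF z] by simp
  then have "\<forall>\<^sub>F n in sequentially. dist (F (r (r' n)) z) (G z) < e"
    using e(1) by (rule tendstoD)
  then show False
    using r(2) by (auto simp: eventually_sequentially)
qed

definition complex_mgf :: "real measure \<Rightarrow> complex \<Rightarrow> complex" where
  "complex_mgf \<mu> z = (\<integral>x. exp (z * of_real x) \<partial>\<mu>)"

lemma integrable_complex_mgf:
  assumes [measurable_cong]: "sets \<mu> = sets borel" and "integrable \<mu> (\<lambda>x. exp (Re z * x))"
  shows "integrable \<mu> (\<lambda>x. exp (z * of_real x))"
  by (rule Bochner_Integration.integrable_bound[OF assms(2)]) (auto)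

lemma norm_complex_mgf_le:
  shows "norm (complex_mgf \<mu> z) \<le> (\<integral>x. exp (Re z * x) \<partial>\<mu>)"
  unfolding complex_mgf_def by (rule integral_norm_bound[THEN order_trans]) simp

lemma complex_mgf_of_real: "complex_mgf \<mu> (of_real a) = of_real (\<integral>x. exp (a * x) \<partial>\<mu>)"
  unfolding complex_mgf_def by (simp flip: integral_complex_of_real of_real_mult exp_of_real)

text \<open>
  Differentiation under the integral sign: with \<open>d = Re z / 2\<close> and \<open>|w - z| < d / 2\<close>, the difference
  quotients of \<open>exp (w x)\<close> in \<open>w\<close> are dominated by a multiple of
  \<open>exp ((Re z + d) x) + exp ((Re z - d) x)\<close>, and both exponents are positive multiples of \<open>x\<close>.
\<close>

lemma holomorphic_complex_mgf:
  assumes [simp, measurable_cong]: "sets \<mu> = sets borel" and int: "\<And>a. a > 0 \<Longrightarrow> integrable \<mu> (\<lambda>x. exp (a * x))"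
  shows "complex_mgf \<mu> holomorphic_on {z. 0 < Re z}"
proof (rule holomorphic_onI)
  fix z assume "z \<in> {z. 0 < Re z}"
  define d where "d = Re z / 2"
  have d: "d > 0" "Re z - d > 0" using \<open>z \<in> _\<close> by (auto simp: d_def)
  let ?q = "\<lambda>w x. (exp (w * of_real x) - exp (z * of_real x)) / (w - z)"
  let ?M = "\<lambda>x. (2 / d) * (exp ((Re z + d) * x) + exp ((Re z - d) * x))"
  have M: "integrable \<mu> ?M"
    using d by (intro integrable_mult_right Bochner_Integration.integrable_add int) auto
  have bound: "norm (?q w x) \<le> ?M x" if w: "w \<noteq> z" "norm (w - z) < d / 2" for w :: complex and x :: real
  proof -
    have "norm (exp ((w - z) * of_real x) - 1) \<le> exp \<bar>Re ((w - z) * of_real x)\<bar> * norm ((w - z) * of_real x)"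
      using Taylor_exp[of "(w - z) * of_real x" 0] by simp
    also have "\<dots> \<le> exp (d / 2 * \<bar>x\<bar>) * norm ((w - z) * of_real x)"
    proof -
      have "\<bar>Re ((w - z) * of_real x)\<bar> \<le> norm (w - z) * \<bar>x\<bar>"
        using abs_Re_le_cmod[of "(w - z) * of_real x"] by (simp add: norm_mult)
      also have "\<dots> \<le> d / 2 * \<bar>x\<bar>" using w by (intro mult_right_mono) auto
      finally show ?thesis by (intro mult_right_mono) auto
    qed
    finally have 1: "norm (exp ((w - z) * of_real x) - 1) \<le> exp (d / 2 * \<bar>x\<bar>) * norm (w - z) * \<bar>x\<bar>"
      by (simp add: norm_mult)
    have "norm (?q w x) = exp (Re z * x) * (norm (exp ((w - z) * of_real x) - 1) / norm (w - z))"
    proof -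
      have "exp (w * of_real x) - exp (z * of_real x) = exp (z * of_real x) * (exp ((w - z) * of_real x) - 1)"
        by (simp add: algebra_simps flip: exp_add)
      then show ?thesis by (simp add: norm_mult norm_divide)
    qed
    also have "\<dots> \<le> exp (Re z * x) * (exp (d / 2 * \<bar>x\<bar>) * \<bar>x\<bar>)"
      using 1 w by (intro mult_left_mono) (auto simp: divide_simps mult_ac)
    also have "\<dots> \<le> exp (Re z * x) * (exp (d / 2 * \<bar>x\<bar>) * (2 / d * exp (d / 2 * \<bar>x\<bar>)))"
    proof -
      have "d * \<bar>x\<bar> \<le> exp (d * \<bar>x\<bar> / 2) * 2"
        using exp_ge_add_one_self[of "d * \<bar>x\<bar> / 2"] by linarith
      then have "\<bar>x\<bar> \<le> 2 / d * exp (d / 2 * \<bar>x\<bar>)"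
        using d by (simp add: field_simps)
      then show ?thesis by (intro mult_left_mono) auto
    qed
    also have "\<dots> = 2 / d * exp (Re z * x + d * \<bar>x\<bar>)"
    proof -
      have "exp (d / 2 * \<bar>x\<bar>) * exp (d / 2 * \<bar>x\<bar>) = exp (d * \<bar>x\<bar>)"
        unfolding exp_add[symmetric] by (simp add: field_simps)
      then show ?thesis unfolding exp_add by (metis mult.assoc mult.left_commute)
    qed
    also have "\<dots> \<le> ?M x"
    proof -
      have "exp (Re z * x + d * \<bar>x\<bar>) \<le> exp ((Re z + d) * x) + exp ((Re z - d) * x)"
        by (cases "x \<ge> 0") (auto simp: algebra_simps abs_if)
      then show ?thesis using d by (intro mult_left_mono) auto
    qed
    finally show ?thesis .
  qed
  have "(complex_mgf \<mu> has_field_derivative (\<integral>x. of_real x * exp (z * of_real x) \<partial>\<mu>)) (at z within ball z (d / 2))"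
    unfolding has_field_derivative_iff tendsto_at_iff_sequentially
  proof safe
    fix X :: "nat \<Rightarrow> complex"
    assume X: "\<forall>i. X i \<in> ball z (d / 2) - {z}" "X \<longlonglongrightarrow> z"
    have Xi: "X i \<noteq> z" "norm (X i - z) < d / 2" for i
      using X(1) by (auto simp: dist_norm norm_minus_commute)
    have RX: "Re (X i) > 0" for i
    proof -
      have "\<bar>Re (X i - z)\<bar> < d / 2" using abs_Re_le_cmod Xi(2) le_less_trans by blast
      then show ?thesis using d unfolding minus_complex.simps d_def by linarith
    qed
    have "(\<lambda>i. \<integral>x. ?q (X i) x \<partial>\<mu>) \<longlonglongrightarrow> (\<integral>x. of_real x * exp (z * of_real x) \<partial>\<mu>)"
    proof (rule integral_dominated_convergence[OF _ _ M])
      show "AE x in \<mu>. (\<lambda>i. ?q (X i) x) \<longlonglongrightarrow> of_real x * exp (z * of_real x)"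
      proof (rule AE_I2)
        fix x :: real
        have "((\<lambda>w. exp (w * of_real x)) has_field_derivative of_real x * exp (z * of_real x)) (at z)"
          by (auto intro!: derivative_eq_intros)
        then show "(\<lambda>i. ?q (X i) x) \<longlonglongrightarrow> of_real x * exp (z * of_real x)"
          unfolding has_field_derivative_iff tendsto_at_iff_sequentially
          using X(2) Xi(1) by (auto simp: o_def)
      qed
      show "AE x in \<mu>. norm (?q (X i) x) \<le> ?M x" for i
        using bound[OF Xi] by auto
    qed auto
    moreover have "(\<integral>x. ?q (X i) x \<partial>\<mu>) = (complex_mgf \<mu> (X i) - complex_mgf \<mu> z) / (X i - z)" for i
      unfolding complex_mgf_def
      using RX d int by (subst Bochner_Integration.integral_diff[symmetric])
         (auto intro!: integrable_complex_mgf simp: d_def)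
    ultimately show "((\<lambda>y. (complex_mgf \<mu> y - complex_mgf \<mu> z) / (y - z)) \<circ> X)
        \<longlonglongrightarrow> (\<integral>x. of_real x * exp (z * of_real x) \<partial>\<mu>)"
      by (simp only: o_def)
  qed
  then have "(complex_mgf \<mu> has_field_derivative (\<integral>x. of_real x * exp (z * of_real x) \<partial>\<mu>)) (at z)"
    using at_within_open[of z "ball z (d / 2)"] d by (simp only: open_ball centre_in_ball half_gt_zero)
  then show "complex_mgf \<mu> field_differentiable at z within {z. 0 < Re z}"
    unfolding field_differentiable_def by (intro exI, rule has_field_derivative_at_within)
qed

text \<open>
  The characteristic function lies on the boundary of the half-plane where the transform is
  holomorphic. This estimate crosses the gap, and it is uniform over families of measures whose real
  transforms converge. It rests on
  \<open>E |1 - exp (\<epsilon> X)| = 2 E max 0 (exp (\<epsilon> X) - 1) + 1 - E exp (\<epsilon> X)\<close>, where the maximum is at most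
  \<open>\<epsilon> exp X\<close> by convexity.
\<close>

lemma complex_mgf_near_char:
  assumes "real_distribution \<mu>" and int: "\<And>a. a > 0 \<Longrightarrow> integrable \<mu> (\<lambda>x. exp (a * x))"
    and e: "0 < \<epsilon>" "\<epsilon> \<le> 1"
  shows "norm (complex_mgf \<mu> (Complex \<epsilon> t) - char \<mu> t) \<le>
           2 * \<epsilon> * (\<integral>x. exp (1 * x) \<partial>\<mu>) + 1 - (\<integral>x. exp (\<epsilon> * x) \<partial>\<mu>)"
proof -
  interpret real_distribution \<mu> by fact
  have i1: "integrable \<mu> (\<lambda>x. exp (Complex \<epsilon> t * of_real x))"
    by (rule integrable_complex_mgf) (use int e in auto)
  have i2: "integrable \<mu> (\<lambda>x. iexp (t * x))"
    by (rule integrable_iexp) auto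
  have "complex_mgf \<mu> (Complex \<epsilon> t) - char \<mu> t = (\<integral>x. exp (Complex \<epsilon> t * of_real x) - iexp (t * x) \<partial>\<mu>)"
    unfolding complex_mgf_def char_def using i1 i2 by simp
  also have "norm \<dots> \<le> (\<integral>x. norm (exp (Complex \<epsilon> t * of_real x) - iexp (t * x)) \<partial>\<mu>)"
    by (rule integral_norm_bound)
  also have "\<dots> \<le> (\<integral>x. 2 * \<epsilon> * exp (1 * x) + 1 - exp (\<epsilon> * x) \<partial>\<mu>)"
  proof (rule integral_mono)
    fix x :: real
    have "exp (Complex \<epsilon> t * of_real x) - iexp (t * x) = of_real (exp (\<epsilon> * x) - 1) * iexp (t * x)"
    proof -
      have "Complex \<epsilon> t * of_real x = of_real (\<epsilon> * x) + \<i> * of_real (t * x)"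
        by (simp add: complex_eq_iff)
      then show ?thesis by (simp add: exp_add algebra_simps exp_of_real flip: of_real_mult)
    qed
    then have "norm (exp (Complex \<epsilon> t * of_real x) - iexp (t * x)) = \<bar>exp (\<epsilon> * x) - 1\<bar>"
      by (simp add: norm_mult del: of_real_diff of_real_mult)
    also have "\<dots> \<le> 2 * \<epsilon> * exp (1 * x) + 1 - exp (\<epsilon> * x)"
    proof -
      have "exp ((1 - \<epsilon>) *\<^sub>R 0 + \<epsilon> *\<^sub>R x) \<le> (1 - \<epsilon>) * exp 0 + \<epsilon> * exp x"
        using e by (intro convex_onD[OF exp_convex]) auto
      then have "exp (\<epsilon> * x) - 1 \<le> \<epsilon> * (exp x - 1)" by (simp add: algebra_simps)
      also have "\<dots> \<le> \<epsilon> * exp x" using e by simp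
      finally have "exp (\<epsilon> * x) - 1 \<le> \<epsilon> * exp x" .
      moreover have "0 \<le> \<epsilon> * exp x" using e by simp
      ultimately show ?thesis by (simp add: abs_if)
    qed
    finally show "norm (exp (Complex \<epsilon> t * of_real x) - iexp (t * x)) \<le> 2 * \<epsilon> * exp (1 * x) + 1 - exp (\<epsilon> * x)" .
  qed (use i1 i2 int[of 1] int[of \<epsilon>] e in auto)
  also have "\<dots> = 2 * \<epsilon> * (\<integral>x. exp (1 * x) \<partial>\<mu>) + 1 - (\<integral>x. exp (\<epsilon> * x) \<partial>\<mu>)"
    using int[of 1] int[of \<epsilon>] e prob_space by simp
  finally show ?thesis .
qed

text \<open>
  A continuity theorem for the one-sided Laplace transform. Vitali's theorem carries the convergence
  from the positive real axis to the open right half-plane, \<open>complex_mgf_near_char\<close> from there to the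
  imaginary axis, and Levy's continuity theorem concludes. The exponents are positive because the
  limit variable below is decreasing in a Levy process with a heavy upper tail, whose moment
  generating function is finite on one half-line only.
\<close>

lemma weak_conv_of_mgf:
  assumes \<mu>: "\<And>n. real_distribution (\<mu> n)" and \<nu>: "real_distribution \<nu>"
    and int\<mu>: "\<And>n a. a > 0 \<Longrightarrow> integrable (\<mu> n) (\<lambda>x. exp (a * x))"
    and int\<nu>: "\<And>a. a > 0 \<Longrightarrow> integrable \<nu> (\<lambda>x. exp (a * x))"
    and lim: "\<And>a. a > 0 \<Longrightarrow> (\<lambda>n. \<integral>x. exp (a * x) \<partial>\<mu> n) \<longlonglongrightarrow> (\<integral>x. exp (a * x) \<partial>\<nu>)"
  shows "weak_conv_m \<mu> \<nu>"
proof (rule levy_continuity[OF \<mu> \<nu>])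
  fix t :: real
  define S where "S = {z. 0 < Re z}"
  interpret N: real_distribution \<nu> by fact
  have S: "open S" "connected S"
    unfolding S_def by (simp_all add: open_halfspace_Re_gt convex_connected convex_halfspace_Re_gt)
  have [simp]: "sets (\<mu> n) = sets borel" for n
    using \<mu>[of n] by (simp add: real_distribution_def real_distribution_axioms_def)
  have conv: "(\<lambda>n. complex_mgf (\<mu> n) z) \<longlonglongrightarrow> complex_mgf \<nu> z" if "z \<in> S" for z
  proof (rule Vitali_convergence[OF S _ _ _ _ _ _ _ that, where U = "of_real ` {0<..}" and \<xi> = 1])
    show "complex_mgf (\<mu> n) holomorphic_on S" for n
      unfolding S_def by (rule holomorphic_complex_mgf) (auto simp: int\<mu>)
    show "complex_mgf \<nu> holomorphic_on S"
      unfolding S_def by (rule holomorphic_complex_mgf) (auto simp: int\<nu>)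
    show "\<exists>B. \<forall>n. \<forall>z\<in>K. norm (complex_mgf (\<mu> n) z) \<le> B" if K: "compact K" "K \<subseteq> S" for K
    proof (cases "K = {}")
      case False
      have "compact (Re ` K)"
        using K by (intro compact_continuous_image continuous_intros)
      then obtain \<beta> where \<beta>: "\<beta> \<in> Re ` K" "\<And>z. z \<in> K \<Longrightarrow> Re z \<le> \<beta>"
        using compact_attains_sup[of "Re ` K"] False by auto
      then have "\<beta> > 0" using K by (auto simp: S_def)
      have "Bseq (\<lambda>n. \<integral>x. exp (\<beta> * x) \<partial>\<mu> n)"
        using lim[OF \<open>\<beta> > 0\<close>] by (intro convergent_imp_Bseq) (auto simp: convergent_def)
      then obtain B where B: "\<And>n. norm (\<integral>x. exp (\<beta> * x) \<partial>\<mu> n) \<le> B"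
        by (auto simp: Bseq_def)
      have "norm (complex_mgf (\<mu> n) z) \<le> B + 1" if z: "z \<in> K" for n z
      proof -
        interpret real_distribution "\<mu> n" by fact
        have "norm (complex_mgf (\<mu> n) z) \<le> (\<integral>x. exp (Re z * x) \<partial>\<mu> n)"
          by (rule norm_complex_mgf_le)
        also have "\<dots> \<le> (\<integral>x. exp (\<beta> * x) + 1 \<partial>\<mu> n)"
        proof (rule integral_mono)
          fix x :: real
          show "exp (Re z * x) \<le> exp (\<beta> * x) + 1"
          proof (cases "x \<ge> 0")
            case True
            then have "exp (Re z * x) \<le> exp (\<beta> * x)" using \<beta>(2)[OF z] by (simp add: mult_right_mono)
            then show ?thesis by linarith
          next
            case False
            then have "exp (Re z * x) \<le> 1" using K z by (auto simp: S_def mult_nonneg_nonpos)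
            then show ?thesis using exp_gt_zero[of "\<beta> * x"] by linarith
          qed
        qed (use K z \<open>\<beta> > 0\<close> in \<open>auto simp: S_def intro!: int\<mu> Bochner_Integration.integrable_add\<close>)
        also have "\<dots> = (\<integral>x. exp (\<beta> * x) \<partial>\<mu> n) + 1"
          using int\<mu>[OF \<open>\<beta> > 0\<close>] prob_space by simp
        also have "\<dots> \<le> B + 1" using B[of n] by simp
        finally show ?thesis .
      qed
      then show ?thesis by blast
    qed auto
    show "(1::complex) islimpt of_real ` {0::real<..}"
    proof -
      have "(\<lambda>n. of_real (1 + 1 / real (Suc n)) :: complex) \<longlonglongrightarrow> of_real (1 + 0)"
        by (intro tendsto_intros LIMSEQ_Suc lim_const_over_n)
      then show ?thesis
        unfolding islimpt_sequential
        by (intro exI[of _ "\<lambda>n. of_real (1 + 1 / real (Suc n))"]) (auto simp: complex_eq_iff simp del: of_nat_Suc intro!: imageI add_pos_nonneg)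
    qed
    show "(\<lambda>n. complex_mgf (\<mu> n) z) \<longlonglongrightarrow> complex_mgf \<nu> z" if "z \<in> of_real ` {0<..}" for z
      using that lim by (auto simp: complex_mgf_of_real intro!: tendsto_of_real)
  qed (auto simp: S_def)
  \<comment> \<open>bounds the change of the transform between the imaginary axis and the line \<open>Re z = \<epsilon>\<close>\<close>
  define R :: "real measure \<Rightarrow> real \<Rightarrow> real" where
    "R \<mu> \<epsilon> = 2 * \<epsilon> * (\<integral>x. exp (1 * x) \<partial>\<mu>) + 1 - (\<integral>x. exp (\<epsilon> * x) \<partial>\<mu>)" for \<mu> \<epsilon>
  have R0: "((\<lambda>\<epsilon>. R \<nu> \<epsilon>) \<longlongrightarrow> 0) (at_right 0)"
  proof -
    have "((\<lambda>\<epsilon>. \<integral>x. exp (\<epsilon> * x) \<partial>\<nu>) \<longlongrightarrow> (\<integral>x. 1 \<partial>\<nu>)) (at 0 within {0..1})"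
      unfolding tendsto_at_iff_sequentially o_def
    proof safe
      fix X :: "nat \<Rightarrow> real" assume X: "\<forall>i. X i \<in> {0..1} - {0}" "X \<longlonglongrightarrow> 0"
      show "(\<lambda>i. \<integral>x. exp (X i * x) \<partial>\<nu>) \<longlonglongrightarrow> (\<integral>x. 1 \<partial>\<nu>)"
      proof (rule integral_dominated_convergence[where w = "\<lambda>x. 1 + exp (1 * x)"])
        show "AE x in \<nu>. (\<lambda>i. exp (X i * x)) \<longlonglongrightarrow> 1"
        proof (rule AE_I2)
          fix x
          have "(\<lambda>i. exp (X i * x)) \<longlonglongrightarrow> exp (0 * x)" by (intro tendsto_intros X)
          then show "(\<lambda>i. exp (X i * x)) \<longlonglongrightarrow> 1" by simp
        qed
        show "AE x in \<nu>. norm (exp (X i * x)) \<le> 1 + exp (1 * x)" for i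
        proof (rule AE_I2)
          fix x :: real
          have "0 \<le> X i" "X i \<le> 1" using X(1) by auto
          then have "exp (X i * x) \<le> 1 \<or> exp (X i * x) \<le> exp x"
            by (cases "x \<ge> 0") (auto simp: mult_left_le_one_le mult_nonneg_nonpos)
          then show "norm (exp (X i * x)) \<le> 1 + exp (1 * x)"
            using exp_gt_zero[of x] by (simp; linarith)
        qed
        show "integrable \<nu> (\<lambda>x. 1 + exp (1 * x))" by (intro Bochner_Integration.integrable_add int\<nu>) auto
      qed auto
    qed
    then have *: "((\<lambda>\<epsilon>. \<integral>x. exp (\<epsilon> * x) \<partial>\<nu>) \<longlongrightarrow> 1) (at_right 0)"
      using N.prob_space by (simp add: at_within_Icc_at_right)
    have "((\<lambda>\<epsilon>. R \<nu> \<epsilon>) \<longlongrightarrow> 2 * 0 * (\<integral>x. exp (1 * x) \<partial>\<nu>) + 1 - 1) (at_right 0)"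
      unfolding R_def by (intro tendsto_intros *)
    then show ?thesis by simp
  qed
  show "(\<lambda>n. char (\<mu> n) t) \<longlonglongrightarrow> char \<nu> t"
  proof (rule tendstoI)
    fix e :: real assume "e > 0"
    have "eventually (\<lambda>\<epsilon>. R \<nu> \<epsilon> < e / 4) (at_right 0)"
      using order_tendstoD(2)[OF R0, of "e / 4"] \<open>e > 0\<close> by simp
    moreover have "eventually (\<lambda>\<epsilon>. \<epsilon> \<in> {0<..<1::real}) (at_right 0)"
      by (rule eventually_at_right_real) simp
    ultimately have "eventually (\<lambda>\<epsilon>. R \<nu> \<epsilon> < e / 4 \<and> \<epsilon> \<in> {0<..<1}) (at_right 0)"
      by eventually_elim simp
    then obtain \<epsilon> where \<epsilon>: "R \<nu> \<epsilon> < e / 4" "0 < \<epsilon>" "\<epsilon> < 1"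
      using eventually_happens'[of "at_right (0::real)"] by fastforce
    have "(\<lambda>n. R (\<mu> n) \<epsilon>) \<longlonglongrightarrow> R \<nu> \<epsilon>"
      unfolding R_def using \<epsilon> by (intro tendsto_intros lim) auto
    then have "\<forall>\<^sub>F n in sequentially. R (\<mu> n) \<epsilon> < e / 4"
      using \<epsilon>(1) by (rule order_tendstoD(2))
    moreover have "\<forall>\<^sub>F n in sequentially. dist (complex_mgf (\<mu> n) (Complex \<epsilon> t)) (complex_mgf \<nu> (Complex \<epsilon> t)) < e / 4"
      using conv[of "Complex \<epsilon> t"] \<epsilon> \<open>e > 0\<close> by (intro tendstoD) (auto simp: S_def)
    ultimately show "\<forall>\<^sub>F n in sequentially. dist (char (\<mu> n) t) (char \<nu> t) < e"
    proof eventually_elim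
      case (elim n)
      have "norm (complex_mgf (\<mu> n) (Complex \<epsilon> t) - char (\<mu> n) t) \<le> R (\<mu> n) \<epsilon>"
        unfolding R_def by (rule complex_mgf_near_char[OF \<mu> int\<mu>]) (use \<epsilon> in auto)
      moreover have "norm (complex_mgf \<nu> (Complex \<epsilon> t) - char \<nu> t) \<le> R \<nu> \<epsilon>"
        unfolding R_def by (rule complex_mgf_near_char[OF \<nu> int\<nu>]) (use \<epsilon> in auto)
      ultimately show ?case
        using elim \<epsilon>(1) \<open>e > 0\<close> unfolding dist_norm by norm
    qed
  qed
qed


section \<open>The compensated exponential and the Laplace exponent\<close>

text \<open>
  As \<open>q\<close> tends to 0, this is the limit of the centred cumulant generating function of a Bernoulli
  variable with success probability \<open>1 - q\<close>, divided by \<open>q\<close>; it is also the integrand of the Laplace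
  exponent for jumps below 1.
\<close>

definition comp_exp :: "real \<Rightarrow> real" where
  "comp_exp u = exp (- u) - 1 + u"

lemma comp_exp_nonneg: "0 \<le> comp_exp u"
  unfolding comp_exp_def using exp_ge_add_one_self[of "- u"] by simp

text \<open>
  The derivative \<open>1 - exp (- u)\<close> lies between \<open>0\<close> and \<open>min 1 u\<close>.
\<close>

lemma comp_exp_diff_bounds:
  assumes "0 \<le> u" "u \<le> w"
  shows "0 \<le> comp_exp w - comp_exp u" "comp_exp w - comp_exp u \<le> (w - u) * min 1 w"
proof -
  have eq: "comp_exp w - comp_exp u = (w - u) - exp (- w) * (exp (w - u) - 1)"
    by (simp add: comp_exp_def algebra_simps flip: exp_add)
  have "exp (- u) * (1 - exp (u - w)) \<le> 1 * (w - u)"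
  proof (intro mult_mono)
    show "1 - exp (u - w) \<le> w - u" using exp_ge_add_one_self[of "u - w"] by linarith
  qed (use assms in auto)
  moreover have "exp (- u) * (1 - exp (u - w)) = exp (- w) * (exp (w - u) - 1)"
    by (simp add: algebra_simps flip: exp_add)
  ultimately show "0 \<le> comp_exp w - comp_exp u" unfolding eq by simp
  have e: "w - u \<le> exp (w - u) - 1" using exp_ge_add_one_self[of "w - u"] by linarith
  then have "0 \<le> exp (- w) * (exp (w - u) - 1)" using assms by simp
  then have 1: "comp_exp w - comp_exp u \<le> w - u" unfolding eq by simp
  have "(1 - w) * (w - u) \<le> exp (- w) * (w - u)"
  proof (intro mult_right_mono)
    show "1 - w \<le> exp (- w)" using exp_ge_add_one_self[of "- w"] by linarith
  qed (use assms in auto)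
  also have "\<dots> \<le> exp (- w) * (exp (w - u) - 1)"
    using e by (intro mult_left_mono) auto
  finally have 2: "comp_exp w - comp_exp u \<le> (w - u) * w" unfolding eq by (simp add: algebra_simps)
  show "comp_exp w - comp_exp u \<le> (w - u) * min 1 w"
    using 1 2 by (simp add: min_def)
qed

lemma comp_exp_le: "0 \<le> u \<Longrightarrow> comp_exp u \<le> u * min 1 u"
  using comp_exp_diff_bounds(2)[of 0 u] by (simp add: comp_exp_def)

lemma comp_exp_lipschitz:
  assumes "0 \<le> u" "u \<le> z" "0 \<le> w" "w \<le> z"
  shows "\<bar>comp_exp u - comp_exp w\<bar> \<le> \<bar>u - w\<bar> * min 1 z"
proof -
  have *: "\<bar>comp_exp u - comp_exp w\<bar> \<le> \<bar>u - w\<bar> * min 1 z"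
    if "0 \<le> u" "u \<le> w" "w \<le> z" for u w
  proof -
    have "comp_exp w - comp_exp u \<le> (w - u) * min 1 w"
      using comp_exp_diff_bounds(2) that by blast
    also have "\<dots> \<le> (w - u) * min 1 z" using that by (intro mult_left_mono) auto
    finally show ?thesis using comp_exp_diff_bounds(1)[of u w] that by (simp add: abs_minus_commute)
  qed
  show ?thesis
    using *[of u w] *[of w u] assms by (cases "u \<le> w") (auto simp: abs_minus_commute)
qed

text \<open>
  The atom of the Levy measure at \<open>B^(r+k)\<close> has mass \<open>B^(-k-r)\<close>. The atoms with \<open>k \<ge> 0\<close> are at least
  1 and not compensated (\<open>large_term\<close>), those at \<open>B^(r-k-1)\<close> are smaller than 1 and compensated
  (\<open>small_term\<close>).
\<close>

definition large_term :: "real \<Rightarrow> real \<Rightarrow> real \<Rightarrow> nat \<Rightarrow> real" where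
  "large_term B a r k = B powr (- real k - r) * (exp (- a * B powr (real k + r)) - 1)"

definition small_term :: "real \<Rightarrow> real \<Rightarrow> real \<Rightarrow> nat \<Rightarrow> real" where
  "small_term B a r k = B powr (real (Suc k) - r) * comp_exp (a * B powr (r - real (Suc k)))"

lemma large_term_bound:
  assumes "B > 1" "0 \<le> r" "0 \<le> a"
  shows "\<bar>large_term B a r k\<bar> \<le> (1 / B) ^ k"
proof -
  have "\<bar>exp (- a * B powr (real k + r)) - 1\<bar> \<le> 1"
  proof -
    have "exp (- a * B powr (real k + r)) \<le> 1" using assms by simp
    then show ?thesis using exp_gt_zero[of "- a * B powr (real k + r)"] by linarith
  qed
  then have "\<bar>large_term B a r k\<bar> \<le> B powr (- real k - r) * 1"
    unfolding large_term_def abs_mult by (intro mult_mono) auto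
  also have "\<dots> \<le> B powr (- real k)" using assms by (simp add: powr_mono)
  also have "\<dots> = (1 / B) ^ k" using assms by (simp add: powr_minus powr_realpow power_divide inverse_eq_divide)
  finally show ?thesis .
qed

lemma small_term_bound:
  assumes "B > 1" "r \<le> 1" "0 \<le> a"
  shows "\<bar>small_term B a r k\<bar> \<le> a\<^sup>2 * (1 / B) ^ k"
proof -
  define u where "u = a * B powr (r - real (Suc k))"
  have "0 \<le> u" using assms by (simp add: u_def)
  then have "comp_exp u \<le> u * u"
    by (intro order_trans[OF comp_exp_le] mult_left_mono) auto
  then have "\<bar>small_term B a r k\<bar> \<le> B powr (real (Suc k) - r) * (u * u)"
    unfolding small_term_def abs_mult u_def[symmetric] using comp_exp_nonneg[of u] by (intro mult_mono) auto
  also have "\<dots> = a\<^sup>2 * (B powr (real (Suc k) - r) * B powr (r - real (Suc k)) * B powr (r - real (Suc k)))"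
    by (simp add: u_def power2_eq_square)
  also have "B powr (real (Suc k) - r) * B powr (r - real (Suc k)) = 1"
    using assms by (subst powr_add[symmetric]) simp
  also have "a\<^sup>2 * (1 * B powr (r - real (Suc k))) \<le> a\<^sup>2 * B powr (- real k)"
    using assms by (intro mult_left_mono) (auto intro!: powr_mono)
  also have "B powr (- real k) = (1 / B) ^ k"
    using assms by (simp add: powr_minus powr_realpow power_divide inverse_eq_divide)
  finally show ?thesis .
qed

lemma summable_geometric_inverse: "B > 1 \<Longrightarrow> summable (\<lambda>k. (1 / B :: real) ^ k)"
  by (rule summable_geometric) simp

lemma Psi_eq_suminf:
  assumes b: "b \<ge> 2" and \<rho>: "0 \<le> \<rho>" "\<rho> < 1" and a: "a \<ge> 0"
  shows "Psi b \<rho> a = (\<Sum>k. large_term (real b) a \<rho> k) + (\<Sum>k. small_term (real b) a \<rho> k)"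
proof -
  define B where "B = real b"
  have B: "B > 1" using b by (simp add: B_def)
  define G where "G = (\<lambda>x::real. indicator {0<..} x *\<^sub>R (exp (- a * x) - 1 + a * x * indicator {x. x < 1} x))"
  define T where "T = (\<lambda>k::int. B powr (real_of_int k - \<rho>) * G (B powr (\<rho> - real_of_int k)))"
  have [measurable]: "G \<in> borel_measurable borel"
    unfolding G_def by measurable
  have "Psi b \<rho> a = (\<integral>x. G x \<partial>Lambda_atoms b \<rho>)"
    unfolding Psi_def set_lebesgue_integral_def Lambda_measure_eq[OF b] G_def ..
  also have "\<dots> = (\<integral>k. G (B powr (\<rho> - real_of_int k))
        \<partial>density (count_space UNIV) (\<lambda>k::int. ennreal (B powr (real_of_int k - \<rho>))))"
    unfolding Lambda_atoms_def B_def[symmetric] by (rule integral_distr) auto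
  also have "\<dots> = (\<integral>k. B powr (real_of_int k - \<rho>) *\<^sub>R G (B powr (\<rho> - real_of_int k)) \<partial>count_space UNIV)"
    by (rule integral_density) auto
  also have "\<dots> = infsetsum T UNIV"
    by (simp add: infsetsum_def T_def)
  finally have Psi: "Psi b \<rho> a = infsetsum T UNIV" .
  have large: "T (- int k) = large_term B a \<rho> k" for k
  proof -
    have "1 \<le> B powr (\<rho> + real k)" using B \<rho> by (intro ge_one_powr_ge_zero) auto
    then show ?thesis using B by (simp add: T_def G_def large_term_def add.commute)
  qed
  have small: "T (int k + 1) = small_term B a \<rho> k" for k
  proof -
    have "B powr (\<rho> - real (Suc k)) < 1" using B \<rho> by (simp add: powr_less_one)
    then show ?thesis using B by (simp add: T_def G_def small_term_def comp_exp_def add.commute)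
  qed
  have bij1: "bij_betw (\<lambda>k. - int k) UNIV {..0}"
    by (rule bij_betwI[where g = "\<lambda>k. nat (- k)"]) auto
  have bij2: "bij_betw (\<lambda>k. int k + 1) UNIV {1..}"
    by (rule bij_betwI[where g = "\<lambda>k. nat (k - 1)"]) auto
  have s1: "Infinite_Set_Sum.abs_summable_on (\<lambda>k. T (- int k)) UNIV"
    unfolding large abs_summable_on_nat_iff'
    by (rule summable_comparison_test[OF _ summable_geometric_inverse[OF B]])
       (use large_term_bound[OF B \<rho>(1) a] in auto)
  have s2: "Infinite_Set_Sum.abs_summable_on (\<lambda>k. T (int k + 1)) UNIV"
    unfolding small abs_summable_on_nat_iff'
    by (rule summable_comparison_test[OF _ summable_mult[OF summable_geometric_inverse[OF B], of "a\<^sup>2"]])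
       (use small_term_bound[OF B _ a] \<rho> in auto)
  have "infsetsum T ({..0} \<union> {1..}) = infsetsum T {..0} + infsetsum T {1..}"
  proof (rule infsetsum_Un_disjoint)
    show "Infinite_Set_Sum.abs_summable_on T {..0}" using s1 abs_summable_on_reindex_bij_betw[OF bij1, of T] by simp
    show "Infinite_Set_Sum.abs_summable_on T {1..}" using s2 abs_summable_on_reindex_bij_betw[OF bij2, of T] by simp
  qed auto
  also have "{..0} \<union> {1..} = (UNIV :: int set)" by auto
  also have "infsetsum T {..0} = (\<Sum>k. large_term B a \<rho> k)"
    using infsetsum_reindex_bij_betw[OF bij1, of T] infsetsum_nat'[OF s1] by (simp add: large)
  also have "infsetsum T {1..} = (\<Sum>k. small_term B a \<rho> k)"
    using infsetsum_reindex_bij_betw[OF bij2, of T] infsetsum_nat'[OF s2] by (simp add: small)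
  finally show ?thesis unfolding Psi B_def .
qed

text \<open>
  Dominated convergence for series, with the summation range growing along the sequence.
\<close>

lemma tendsto_partial_sums:
  fixes A :: "nat \<Rightarrow> real \<Rightarrow> real"
  assumes lim: "\<And>k. (\<lambda>n. A k (r n)) \<longlonglongrightarrow> L k"
    and bound: "\<And>k n. \<bar>A k (r n)\<bar> \<le> M k" and M: "summable M"
    and m: "filterlim m at_top sequentially"
  shows "(\<lambda>n. \<Sum>k<m n. A k (r n)) \<longlonglongrightarrow> (\<Sum>k. L k)"
proof -
  define a where "a k n = (if k < m n then A k (r n) else 0)" for k n
  have "(\<lambda>n. \<Sum>k. a k n) \<longlonglongrightarrow> (\<Sum>k. L k)"
  proof (rule tannerys_theorem[where M = M, THEN conjunct2, THEN conjunct2])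
    show "(\<lambda>n. a k n) \<longlonglongrightarrow> L k" for k
    proof (rule Lim_transform_eventually[OF lim])
      show "\<forall>\<^sub>F n in sequentially. A k (r n) = a k n"
        using filterlim_at_top[THEN iffD1, OF m, rule_format, of "Suc k"] by eventually_elim (simp add: a_def)
    qed
    have "norm (a k n) \<le> M k" for k n
      using bound[of k n] by (auto simp: a_def)
    then show "\<forall>\<^sub>F (k, n) in at_top \<times>\<^sub>F sequentially. norm (a k n) \<le> M k"
      by (simp add: case_prod_unfold)
  qed (use M in auto)
  moreover have "(\<Sum>k. a k n) = (\<Sum>k<m n. A k (r n))" for n
    by (subst suminf_finite[of "{..<m n}"]) (auto simp: a_def)
  ultimately show ?thesis by simp
qed

text \<open>
  Writing \<open>h = B^(m+r)\<close> turns the number \<open>n - l\<close> of generations between a level and the root into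
  the exponent of an atom relative to \<open>m\<close>. The first \<open>m\<close> generations are the large atoms; there the
  compensating linear term does not belong to the Laplace exponent and contributes \<open>a\<close> for each
  generation. These contributions are the source of the logarithmic centring.
\<close>

lemma compensated_sum_split:
  fixes B a :: real
  assumes B: "B > 1" and h: "h = B powr (real m + r)" and mn: "m \<le> n"
  shows "(\<Sum>l<n. B ^ (n - l) * comp_exp (a * h / B ^ (n - l))) / h =
           (\<Sum>k<m. large_term B a r k) + (\<Sum>k<n - m. small_term B a r k) + a * real m"
proof -
  define t where "t i = B ^ i * comp_exp (a * h / B ^ i) / h" for i
  have h0: "h > 0" using B h by simp
  have "(\<Sum>l<n. B ^ (n - l) * comp_exp (a * h / B ^ (n - l))) / h = (\<Sum>l<n. t (n - l))"
    by (simp add: t_def sum_divide_distrib)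
  also have "\<dots> = (\<Sum>i=Suc 0..n. t i)"
    by (rule sum.reindex_bij_witness[where i = "\<lambda>i. n - i" and j = "\<lambda>l. n - l"]) auto
  also have "\<dots> = (\<Sum>i=Suc 0..m. t i) + (\<Sum>i=Suc m..n. t i)"
    using sum.ub_add_nat[of 1 m t "n - m"] mn by simp
  also have "(\<Sum>i=Suc 0..m. t i) = (\<Sum>k<m. t (m - k))"
    by (rule sum.reindex_bij_witness[where i = "\<lambda>i. m - i" and j = "\<lambda>l. m - l"]) auto
  also have "\<dots> = (\<Sum>k<m. large_term B a r k + a)"
  proof (rule sum.cong[OF refl])
    fix k assume "k \<in> {..<m}"
    then have e: "B ^ (m - k) = B powr (real m - real k)"
      using B by (simp add: powr_realpow flip: of_nat_diff)
    have 1: "B ^ (m - k) / h = B powr (- real k - r)"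
      unfolding e h powr_diff[symmetric] by (rule arg_cong[of _ _ "(powr) B"]) simp
    have 2: "h / B ^ (m - k) = B powr (real k + r)"
      unfolding e h by (simp add: algebra_simps flip: powr_diff)
    have "t (m - k) = (B ^ (m - k) / h) * comp_exp (a * (h / B ^ (m - k)))"
      by (simp add: t_def)
    also have "\<dots> = large_term B a r k + a * (B powr (- real k - r) * B powr (real k + r))"
      unfolding 1 2 large_term_def comp_exp_def by (simp add: algebra_simps)
    also have "B powr (- real k - r) * B powr (real k + r) = 1"
      using B by (simp flip: powr_add)
    finally show "t (m - k) = large_term B a r k + a" by simp
  qed
  also have "(\<Sum>i=Suc m..n. t i) = (\<Sum>k<n - m. t (m + Suc k))"
    by (rule sum.reindex_bij_witness[where i = "\<lambda>k. m + Suc k" and j = "\<lambda>i. i - Suc m"]) auto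
  also have "\<dots> = (\<Sum>k<n - m. small_term B a r k)"
  proof (rule sum.cong[OF refl])
    fix k
    have e: "B ^ (m + Suc k) = B powr (real m + real (Suc k))"
      using B powr_realpow[of B "m + Suc k"] by (simp only: of_nat_add)
    have 1: "B ^ (m + Suc k) / h = B powr (real (Suc k) - r)"
      unfolding e h by (simp add: algebra_simps flip: powr_diff)
    have 2: "h / B ^ (m + Suc k) = B powr (r - real (Suc k))"
      unfolding e h by (simp add: algebra_simps flip: powr_diff)
    have "t (m + Suc k) = (B ^ (m + Suc k) / h) * comp_exp (a * (h / B ^ (m + Suc k)))"
      by (simp add: t_def)
    then show "t (m + Suc k) = small_term B a r k"
      unfolding 1 2 small_term_def .
  qed
  finally show ?thesis by (simp add: sum.distrib)
qed

text \<open>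
  With \<open>m\<close> and \<open>r\<close> the integer and fractional parts of \<open>log_b h\<close>, the excess \<open>a m - a log_b h\<close> is
  \<open>- a r\<close>. Only the fractional part survives in the limit, so the limit depends on \<open>\<rho>\<close>.
\<close>

lemma compensated_sum_limit:
  fixes h :: "nat \<Rightarrow> nat"
  assumes b: "b \<ge> 2" and a: "a \<ge> 0" and \<rho>: "0 \<le> \<rho>" "\<rho> < 1"
    and h: "filterlim h at_top sequentially"
    and frac: "(\<lambda>k. frac (log (real b) (real (h k)))) \<longlonglongrightarrow> \<rho>"
  shows "(\<lambda>k. (\<Sum>l<h k. real b ^ (h k - l) * comp_exp (a * real (h k) / real b ^ (h k - l))) / real (h k)
              - a * log (real b) (real (h k))) \<longlonglongrightarrow> Psi b \<rho> a - a * \<rho>"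
proof -
  define B where "B = real b"
  have B: "B > 1" using b by (simp add: B_def)
  define r where "r k = frac (log B (real (h k)))" for k
  define m where "m k = nat \<lfloor>log B (real (h k))\<rfloor>" for k
  have r: "0 \<le> r k" "r k \<le> 1" for k
    using frac_lt_1[of "log B (real (h k))"] by (auto simp: r_def)
  have r_lim: "r \<longlonglongrightarrow> \<rho>" using frac by (simp add: r_def[abs_def] B_def)
  have pos: "\<forall>\<^sub>F k in sequentially. h k \<ge> 1"
    using h by (simp add: filterlim_at_top)
  have log_eq: "log B (real (h k)) = real (m k) + r k" if "h k \<ge> 1" for k
  proof -
    have "0 \<le> log B (real (h k))" using that B by simp
    then show ?thesis by (simp add: m_def r_def frac_def)
  qed
  have h_eq: "real (h k) = B powr (real (m k) + r k)" if "h k \<ge> 1" for k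
    using that B by (subst log_eq[OF that, symmetric]) simp
  have m_less: "B ^ m k \<le> real (h k)" if "h k \<ge> 1" for k
    unfolding h_eq[OF that] using B r[of k] by (simp flip: powr_realpow)
  have log_lim: "filterlim (\<lambda>k. log B (real (h k))) at_top sequentially"
  proof -
    have "filterlim (\<lambda>k. ln (real (h k))) at_top sequentially"
      by (rule filterlim_compose[OF ln_at_top filterlim_compose[OF filterlim_real_sequentially h]])
    then have "filterlim (\<lambda>k. (1 / ln B) * ln (real (h k))) at_top sequentially"
      using B by (intro filterlim_tendsto_pos_mult_at_top[OF tendsto_const]) auto
    then show ?thesis by (simp add: log_def)
  qed
  have m_lim: "filterlim m at_top sequentially"
    unfolding m_def[abs_def]
    by (rule filterlim_compose[OF filterlim_nat_sequentially filterlim_compose[OF filterlim_floor_sequentially log_lim]])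
  have m_le: "2 * m k \<le> h k" if "h k \<ge> 1" for k
  proof -
    have "2 * n \<le> 2 ^ n" for n :: nat
    proof (cases n)
      case (Suc k)
      then show ?thesis using Suc_leI[OF less_exp[of k]] by simp
    qed simp
    then have "real (2 * m k) \<le> 2 ^ m k"
      by (metis of_nat_le_iff of_nat_numeral of_nat_power)
    also have "\<dots> \<le> B ^ m k" using b by (intro power_mono) (auto simp: B_def)
    also have "\<dots> \<le> real (h k)" using m_less[OF that] .
    finally show ?thesis by simp
  qed
  have hm_lim: "filterlim (\<lambda>k. h k - m k) at_top sequentially"
  proof (rule filterlim_at_top_mono[OF m_lim])
    show "\<forall>\<^sub>F k in sequentially. m k \<le> h k - m k"
      using pos
    proof eventually_elim
      case (elim k)
      then show ?case using m_le[OF elim] by linarith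
    qed
  qed
  have large: "(\<lambda>k. \<Sum>j<m k. large_term B a (r k) j) \<longlonglongrightarrow> (\<Sum>j. large_term B a \<rho> j)"
  proof (rule tendsto_partial_sums[OF _ _ summable_geometric_inverse[OF B] m_lim])
    show "(\<lambda>k. large_term B a (r k) j) \<longlonglongrightarrow> large_term B a \<rho> j" for j
      unfolding large_term_def using B by (intro tendsto_intros r_lim) auto
    show "\<bar>large_term B a (r k) j\<bar> \<le> (1 / B) ^ j" for k j
      using large_term_bound[OF B] r a by blast
  qed
  have small: "(\<lambda>k. \<Sum>j<h k - m k. small_term B a (r k) j) \<longlonglongrightarrow> (\<Sum>j. small_term B a \<rho> j)"
  proof (rule tendsto_partial_sums[OF _ _ summable_mult[OF summable_geometric_inverse[OF B]] hm_lim])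
    show "(\<lambda>k. small_term B a (r k) j) \<longlonglongrightarrow> small_term B a \<rho> j" for j
      unfolding small_term_def comp_exp_def using B by (intro tendsto_intros r_lim) auto
    show "\<bar>small_term B a (r k) j\<bar> \<le> a\<^sup>2 * (1 / B) ^ j" for k j
      using small_term_bound[OF B] r a by blast
  qed
  have "(\<lambda>k. (\<Sum>j<m k. large_term B a (r k) j) + (\<Sum>j<h k - m k. small_term B a (r k) j) - a * r k)
          \<longlonglongrightarrow> (\<Sum>j. large_term B a \<rho> j) + (\<Sum>j. small_term B a \<rho> j) - a * \<rho>"
    by (intro tendsto_intros large small r_lim)
  then have "(\<lambda>k. (\<Sum>j<m k. large_term B a (r k) j) + (\<Sum>j<h k - m k. small_term B a (r k) j) - a * r k)
          \<longlonglongrightarrow> Psi b \<rho> a - a * \<rho>"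
    using Psi_eq_suminf[OF b \<rho> a] by (simp add: B_def)
  moreover have "\<forall>\<^sub>F k in sequentially.
      (\<Sum>j<m k. large_term B a (r k) j) + (\<Sum>j<h k - m k. small_term B a (r k) j) - a * r k =
      (\<Sum>l<h k. B ^ (h k - l) * comp_exp (a * real (h k) / B ^ (h k - l))) / real (h k) - a * log B (real (h k))"
    using pos
  proof eventually_elim
    case (elim k)
    have "m k \<le> h k" using m_le[OF elim] by simp
    then show ?case
      using compensated_sum_split[OF B h_eq[OF elim], of "h k" a] log_eq[OF elim]
      by (simp add: algebra_simps)
  qed
  ultimately show ?thesis
    unfolding B_def by (rule Lim_transform_eventually)
qed


section \<open>The recursion for the cumulant\<close>

text \<open>
  With \<open>q = 1 - p\<close>, the first inequality bounds the error in
  \<open>ln (1 - p + p e^u) = p u + q comp_exp u + O(q^2)\<close>. Indeed \<open>ln (1 - p + p e^u) = u + ln (1 - x)\<close>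
  with \<open>x = q (1 - e^(-u))\<close>, which is at most \<open>1/2\<close>, and \<open>ln (1 - x)\<close> differs from \<open>- x\<close> by at most
  \<open>2 x^2\<close>.
\<close>

lemma cumulant_step_bounds:
  fixes p u :: real
  assumes p: "1 / 2 \<le> p" "p \<le> 1" and u: "0 \<le> u"
  shows "\<bar>ln (1 - p + p * exp u) - p * u - (1 - p) * comp_exp u\<bar> \<le> 2 * (1 - p)\<^sup>2 * (u * min 1 u)"
    and "0 \<le> ln (1 - p + p * exp u)" and "ln (1 - p + p * exp u) \<le> u"
proof -
  define x where "x = (1 - p) * (1 - exp (- u))"
  have e: "1 - exp (- u) \<le> u" using exp_ge_add_one_self[of "- u"] by linarith
  have e01: "0 \<le> 1 - exp (- u)" "1 - exp (- u) \<le> 1" using u by auto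
  have "x \<le> 1 / 2 * 1" unfolding x_def using p e01 by (intro mult_mono) auto
  then have x: "0 \<le> x" "x \<le> 1 / 2" using p e01 by (auto simp: x_def)
  have eq: "1 - p + p * exp u = exp u * (1 - x)"
    by (simp add: x_def algebra_simps flip: exp_add)
  have ln: "ln (1 - p + p * exp u) = u + ln (1 - x)"
    unfolding eq using x by (subst ln_mult) auto
  have up: "ln (1 - x) \<le> - x" using ln_add_one_self_le_self2[of "- x"] x by simp
  have low: "- x - 2 * x\<^sup>2 \<le> ln (1 - x)" using ln_one_minus_pos_lower_bound[of x] x by simp
  have x2: "x\<^sup>2 \<le> (1 - p)\<^sup>2 * (u * min 1 u)"
  proof -
    have "(1 - exp (- u))\<^sup>2 \<le> u * min 1 u"
      unfolding power2_eq_square using e e01 u by (intro mult_mono) auto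
    then show ?thesis unfolding x_def power_mult_distrib by (intro mult_left_mono) auto
  qed
  have g: "ln (1 - p + p * exp u) - p * u - (1 - p) * comp_exp u = ln (1 - x) + x"
    unfolding ln by (simp add: x_def comp_exp_def algebra_simps)
  show "\<bar>ln (1 - p + p * exp u) - p * u - (1 - p) * comp_exp u\<bar> \<le> 2 * (1 - p)\<^sup>2 * (u * min 1 u)"
    unfolding g using up low x2 by linarith
  show "ln (1 - p + p * exp u) \<le> u" unfolding ln using up x by linarith
  have "1 + p * 0 \<le> 1 + p * (exp u - 1)" using p u by (intro add_left_mono mult_left_mono) auto
  then show "0 \<le> ln (1 - p + p * exp u)" by (simp add: algebra_simps)
qed

lemma reg_tree_size_0: "b \<ge> 2 \<Longrightarrow> reg_tree_size b 0 = 1"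
  by (simp add: reg_tree_size_def)

lemma reg_tree_size_Suc: "b \<ge> 2 \<Longrightarrow> reg_tree_size b (Suc j) = 1 + real b * reg_tree_size b j"
  by (simp add: reg_tree_size_def field_simps)

lemma reg_tree_size_pos: "b \<ge> 2 \<Longrightarrow> 0 < reg_tree_size b j"
  by (induction j) (auto simp: reg_tree_size_0 reg_tree_size_Suc intro!: add_pos_nonneg)

lemma reg_tree_size_diff_le:
  assumes "b \<ge> 2" "l \<le> h"
  shows "real b ^ (h - l) * reg_tree_size b l \<le> reg_tree_size b h"
proof -
  have "real b ^ (h - l) * (real b ^ (l + 1) - 1) = real b ^ (h + 1) - real b ^ (h - l)"
    using assms by (simp add: algebra_simps flip: power_add power_Suc)
  also have "\<dots> \<le> real b ^ (h + 1) - 1" using assms by simp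
  finally show ?thesis unfolding reg_tree_size_def using assms by (simp add: divide_right_mono)
qed

text \<open>
  The expected size of the root cluster of a tree of height \<open>j\<close>.
\<close>

definition mean_size :: "nat \<Rightarrow> real \<Rightarrow> nat \<Rightarrow> real" where
  "mean_size b p j = (\<Sum>k\<le>j. (real b * p) ^ k)"

lemma mean_size_0 [simp]: "mean_size b p 0 = 1"
  by (simp add: mean_size_def)

lemma mean_size_Suc: "mean_size b p (Suc j) = 1 + real b * p * mean_size b p j"
  unfolding mean_size_def by (subst sum.atMost_Suc_shift) (simp add: sum_distrib_left)

text \<open>
  Splitting off the linear part \<open>b p u\<close> of the recursion and solving the linear recursion leaves the
  mean and a weighted sum of the nonlinear parts of all levels.
\<close>

lemma cumulant_unroll:
  "cumulant b p s j = s * mean_size b p j +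
     (\<Sum>l<j. real b ^ (j - l) * p ^ (j - Suc l) *
        (ln (1 - p + p * exp (cumulant b p s l)) - p * cumulant b p s l))"
proof (induction j)
  case (Suc j)
  define g where "g l = ln (1 - p + p * exp (cumulant b p s l)) - p * cumulant b p s l" for l
  have "(\<Sum>l<Suc j. real b ^ (Suc j - l) * p ^ (Suc j - Suc l) * g l) =
          real b * p * (\<Sum>l<j. real b ^ (j - l) * p ^ (j - Suc l) * g l) + real b * g j"
  proof -
    have "real b ^ (Suc j - l) * p ^ (Suc j - Suc l) * g l =
            real b * p * (real b ^ (j - l) * p ^ (j - Suc l) * g l)" if "l < j" for l
    proof -
      have "Suc j - l = Suc (j - l)" "Suc j - Suc l = Suc (j - Suc l)" using that by auto
      then show ?thesis by simp
    qed
    then have "(\<Sum>l<j. real b ^ (Suc j - l) * p ^ (Suc j - Suc l) * g l) =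
        (\<Sum>l<j. real b * p * (real b ^ (j - l) * p ^ (j - Suc l) * g l))"
      by (intro sum.cong) auto
    then show ?thesis unfolding sum.lessThan_Suc sum_distrib_left by simp
  qed
  then show ?case
    using Suc.IH unfolding g_def[symmetric] by (simp add: mean_size_Suc algebra_simps) (simp add: g_def algebra_simps)
qed simp

text \<open>
  The upper bound is the deterministic one: the cluster has at most as many vertices as the tree.
\<close>

lemma cumulant_bounds:
  assumes b: "b \<ge> 2" and p: "1 / 2 \<le> p" "p \<le> 1" and s: "0 \<le> s"
  shows "0 \<le> cumulant b p s j" "cumulant b p s j \<le> s * reg_tree_size b j"
proof -
  have "0 \<le> cumulant b p s j \<and> cumulant b p s j \<le> s * reg_tree_size b j"
  proof (induction j)
    case 0
    then show ?case using s b by (simp add: reg_tree_size_0)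
  next
    case (Suc j)
    define u where "u = cumulant b p s j"
    have u: "0 \<le> u" "u \<le> s * reg_tree_size b j" using Suc by (auto simp: u_def)
    have "real b * ln (1 - p + p * exp u) \<le> real b * (s * reg_tree_size b j)"
      using cumulant_step_bounds(3)[OF p u(1)] u(2) by (intro mult_left_mono) auto
    then show ?case
      using cumulant_step_bounds(2)[OF p u(1)] s b
      by (simp add: reg_tree_size_Suc algebra_simps flip: u_def)
  qed
  then show "0 \<le> cumulant b p s j" "cumulant b p s j \<le> s * reg_tree_size b j" by auto
qed

text \<open>
  The fraction of the tree that is kept changes little from one level to the next:
  \<open>x_i = b^i mean_size (h - i)\<close> satisfies \<open>x_i - x_(i+1) = b^i - (1 - p) x_(i+1)\<close>, and the geometric
  sum of the \<open>b^l\<close> with \<open>l < i\<close> is at most the fraction \<open>i / h\<close> of the size of the tree.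
\<close>

lemma mean_size_ratio_bound:
  assumes b: "b \<ge> 2" and p: "0 \<le> p" "p \<le> 1" and i: "i \<le> h"
  shows "\<bar>real b ^ i * mean_size b p (h - i) - mean_size b p h\<bar> \<le>
           reg_tree_size b h * (real i / real h + (1 - p) * real i)"
proof -
  define x where "x i = real b ^ i * mean_size b p (h - i)" for i
  have m_nonneg: "0 \<le> mean_size b p j" for j
    unfolding mean_size_def using p by (intro sum_nonneg) auto
  have m_le: "mean_size b p j \<le> reg_tree_size b j" for j
  proof (induction j)
    case (Suc j)
    have "real b * (p * mean_size b p j) \<le> real b * (1 * reg_tree_size b j)"
      using Suc p m_nonneg by (intro mult_left_mono mult_mono) auto
    then show ?case using b by (simp add: mean_size_Suc reg_tree_size_Suc mult.assoc)
  qed (use b in \<open>simp add: reg_tree_size_0\<close>)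
  have x_le: "0 \<le> x i" "x i \<le> reg_tree_size b h" if "i \<le> h" for i
  proof -
    show "0 \<le> x i" using m_nonneg by (simp add: x_def)
    have "x i \<le> real b ^ i * reg_tree_size b (h - i)"
      unfolding x_def using m_le by (intro mult_left_mono) auto
    also have "\<dots> \<le> reg_tree_size b h"
      using reg_tree_size_diff_le[OF b, of "h - i" h] that by simp
    finally show "x i \<le> reg_tree_size b h" .
  qed
  have step: "x i - x (Suc i) = real b ^ i - (1 - p) * x (Suc i)" if "i < h" for i
  proof -
    have "h - i = Suc (h - Suc i)" using that by simp
    then show ?thesis by (simp add: x_def mean_size_Suc algebra_simps)
  qed
  have "\<bar>x i - x 0\<bar> \<le> (\<Sum>l<i. real b ^ l) + (1 - p) * real i * reg_tree_size b h"
    using i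
  proof (induction i)
    case (Suc i)
    have "0 \<le> (1 - p) * x (Suc i)" "(1 - p) * x (Suc i) \<le> (1 - p) * reg_tree_size b h"
      using x_le[of "Suc i"] Suc.prems p by (auto intro!: mult_left_mono)
    moreover have "0 \<le> real b ^ i" by simp
    moreover have "i < h" "i \<le> h" using Suc.prems by auto
    moreover have "(1 - p) * real (Suc i) * reg_tree_size b h =
        (1 - p) * real i * reg_tree_size b h + (1 - p) * reg_tree_size b h"
      by (simp add: algebra_simps)
    ultimately show ?case
      unfolding sum.lessThan_Suc using Suc.IH step[of i] by linarith
  qed simp
  also have "(\<Sum>l<i. real b ^ l) \<le> reg_tree_size b h * (real i / real h)"
  proof -
    have "real h \<le> real i * real b ^ (h + 1 - i)" if "i > 0"
    proof -
      have "h + 1 - i < 2 ^ (h + 1 - i)" by (rule less_exp)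
      also have "\<dots> \<le> b ^ (h + 1 - i)" using b by (intro power_mono) auto
      finally have "i * (h + 1 - i) \<le> i * b ^ (h + 1 - i)" by simp
      moreover have "h \<le> i * (h + 1 - i)"
      proof -
        obtain d where d: "h = i + d" using i le_Suc_ex by blast
        have "d \<le> i * d" using that by (cases i) auto
        then show ?thesis by (simp add: d algebra_simps)
      qed
      ultimately have "h \<le> i * b ^ (h + 1 - i)" by linarith
      then show ?thesis by (metis of_nat_le_iff of_nat_mult of_nat_power)
    qed
    then have *: "real h * (real b ^ i - 1) \<le> real i * (real b ^ (h + 1) - 1)"
    proof (cases "i = 0")
      case False
      then have "real h \<le> real i * real b ^ (h + 1 - i)" using \<open>i > 0 \<Longrightarrow> _\<close> by simp
      then have "real h * real b ^ i \<le> real i * real b ^ (h + 1 - i) * real b ^ i"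
        by (intro mult_right_mono) auto
      also have "\<dots> = real i * real b ^ (h + 1)"
        using i by (simp add: mult.assoc flip: power_add)
      finally show ?thesis using i by (simp add: algebra_simps)
    qed simp
    have "(\<Sum>l<i. real b ^ l) = (real b ^ i - 1) / (real b - 1)"
      using b by (intro geometric_sum) auto
    also have "\<dots> \<le> reg_tree_size b h * (real i / real h)"
    proof (cases "h = 0")
      case False
      then have "real b ^ i - 1 \<le> (real b ^ (h + 1) - 1) * (real i / real h)"
        using * by (simp add: field_simps)
      then have "(real b ^ i - 1) / (real b - 1) \<le> (real b ^ (h + 1) - 1) * (real i / real h) / (real b - 1)"
        using b by (intro divide_right_mono) auto
      then show ?thesis by (simp add: reg_tree_size_def mult_ac)
    qed (use i in simp)
    finally show ?thesis .
  qed
  finally show ?thesis by (simp add: x_def algebra_simps)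
qed

text \<open>
  The scale \<open>s = a h / n_h\<close> gives a subtree of height \<open>l\<close> the weight \<open>z_l = a h / b^(h-l)\<close> at most,
  and to first order the weight \<open>w_l = e^(-c) z_l\<close>, as \<open>e^(-c)\<close> is the fraction of the tree that is
  kept. Replacing the nonlinear part at level \<open>l\<close> by \<open>(c / h) comp_exp w_l\<close> costs at most a multiple
  of \<open>(1 + V) (h - l) min 1 z_l / h\<close>, because \<open>comp_exp\<close> has slope at most \<open>min 1 z_l\<close> on
  \<open>[0, z_l]\<close>. As \<open>V\<close> is the sum of the weights \<open>(h - l) min 1 z_l\<close>, and is much smaller than the
  square root of \<open>h\<close>, the total error vanishes.
\<close>

lemma cumulant_expansion:
  fixes a c K :: real
  assumes b: "b \<ge> 2" and a: "0 \<le> a" and c: "0 < c" and h: "h \<ge> 1" "2 * c \<le> real h"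
    and K: "real h * \<bar>mean_size b p h / reg_tree_size b h - exp (- c)\<bar> \<le> K"
    and p_def: "p = exp (- c / real h)" and s_def: "s = a * real h / reg_tree_size b h"
    and V_def: "V = (\<Sum>l<h. real (h - l) * min 1 (a * real h / real b ^ (h - l)))"
  shows "\<bar>cumulant b p s h - s * mean_size b p h -
            c / real h * (\<Sum>l<h. real b ^ (h - l) * comp_exp (a * exp (- c) * real h / real b ^ (h - l)))\<bar>
         \<le> (4 * a * c\<^sup>2 + a * c * (1 + c + K)) * (V / real h) + 2 * a * c\<^sup>2 * (V\<^sup>2 / real h)"
proof -
  define q where "q = 1 - p"
  define u where "u = cumulant b p s"
  define \<beta> where "\<beta> l = real b ^ (h - l)" for l
  define z where "z l = a * real h / \<beta> l" for l
  define w where "w l = a * exp (- c) * real h / \<beta> l" for l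
  define \<mu> where "\<mu> l = min 1 (z l)" for l
  define g where "g l = ln (1 - p + p * exp (u l)) - p * u l" for l
  have h0: "real h > 0" using h by simp
  have q_ge: "0 \<le> q" using c h0 by (simp add: q_def p_def)
  have q_le: "q \<le> c / real h"
    using exp_ge_add_one_self[of "- c / real h"] unfolding q_def p_def by (simp add: field_simps) 
  have ch: "c / real h \<le> 1 / 2" using h h0 by (simp add: field_simps)
  have p: "1 / 2 \<le> p" "p \<le> 1" using q_le q_ge ch unfolding q_def by linarith+
  have q_diff: "0 \<le> c / real h - q" "c / real h - q \<le> (c / real h) * (c / real h)"
  proof -
    show "0 \<le> c / real h - q" using q_le by simp
    have "c / real h - q = comp_exp (c / real h)"
      by (simp add: q_def p_def comp_exp_def)
    also have "\<dots> \<le> (c / real h) * min 1 (c / real h)"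
      using c h0 by (intro comp_exp_le) simp
    also have "\<dots> \<le> (c / real h) * (c / real h)" using c h0 by (intro mult_left_mono) auto
    finally show "c / real h - q \<le> (c / real h) * (c / real h)" .
  qed
  have qh: "q * real h \<le> c" using q_le h0 by (simp add: field_simps)
  have \<beta>: "0 < \<beta> l" for l using b by (simp add: \<beta>_def)
  have \<beta>z: "\<beta> l * z l = a * real h" for l using \<beta>[of l] by (simp add: z_def)
  have \<beta>w: "\<beta> l * w l = a * exp (- c) * real h" for l using \<beta>[of l] by (simp add: w_def)
  have z: "0 \<le> z l" for l using a \<beta>[of l] by (simp add: z_def)
  have \<mu>: "0 \<le> \<mu> l" for l using z[of l] by (simp add: \<mu>_def)
  have w: "0 \<le> w l" "w l \<le> z l" for l
  proof -
    show "0 \<le> w l" using a \<beta>[of l] by (simp add: w_def)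
    have "a * exp (- c) * real h \<le> a * 1 * real h"
      using a c by (intro mult_right_mono mult_left_mono) auto
    then show "w l \<le> z l" using \<beta>[of l] by (simp add: w_def z_def divide_right_mono)
  qed
  have n: "0 < reg_tree_size b h" by (rule reg_tree_size_pos[OF b])
  have s: "0 \<le> s" using a n by (simp add: s_def)
  have u: "0 \<le> u l" "u l \<le> z l" if "l \<le> h" for l
  proof -
    show "0 \<le> u l" unfolding u_def by (rule cumulant_bounds(1)[OF b p s])
    have "u l \<le> s * reg_tree_size b l" unfolding u_def by (rule cumulant_bounds(2)[OF b p s])
    also have "\<dots> = (a * real h) * (reg_tree_size b l / reg_tree_size b h)" by (simp add: s_def)
    also have "\<dots> \<le> (a * real h) * (1 / \<beta> l)"
      using reg_tree_size_diff_le[OF b that] a n \<beta>[of l]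
      by (intro mult_left_mono) (auto simp: field_simps \<beta>_def)
    finally show "u l \<le> z l" by (simp add: z_def)
  qed
  have uz: "u l * min 1 (u l) \<le> z l * \<mu> l" if "l \<le> h" for l
    unfolding \<mu>_def using u[OF that] z[of l] by (intro mult_mono) auto
  have fu: "comp_exp (u l) \<le> z l * \<mu> l" if "l \<le> h" for l
    using comp_exp_le[OF u(1)[OF that]] uz[OF that] by linarith
  have fw: "comp_exp (w l) \<le> z l * \<mu> l" for l
  proof -
    have "w l * min 1 (w l) \<le> z l * \<mu> l"
      unfolding \<mu>_def using w[of l] z[of l] by (intro mult_mono) auto
    then show ?thesis using comp_exp_le[OF w(1)[of l]] by linarith
  qed
  have g_diff: "\<bar>g l - q * comp_exp (u l)\<bar> \<le> 2 * q\<^sup>2 * (z l * \<mu> l)" if "l \<le> h" for l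
  proof -
    have "\<bar>g l - q * comp_exp (u l)\<bar> \<le> 2 * q\<^sup>2 * (u l * min 1 (u l))"
      unfolding g_def q_def by (rule cumulant_step_bounds(1)[OF p u(1)[OF that]])
    also have "\<dots> \<le> 2 * q\<^sup>2 * (z l * \<mu> l)" using uz[OF that] by (intro mult_left_mono) auto
    finally show ?thesis .
  qed
  have g_bound: "\<bar>\<beta> l * g l\<bar> \<le> 2 * a * c * \<mu> l" if "l \<le> h" for l
  proof -
    have "q \<le> 1 / 2" using q_le ch by linarith
    then have "q * q \<le> 1 / 2 * q" using q_ge by (intro mult_right_mono)
    then have "2 * q\<^sup>2 \<le> q" by (simp add: power2_eq_square)
    then have "2 * q\<^sup>2 * (z l * \<mu> l) \<le> q * (z l * \<mu> l)" using z \<mu> by (intro mult_right_mono) auto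
    moreover have "0 \<le> q * comp_exp (u l)" "q * comp_exp (u l) \<le> q * (z l * \<mu> l)"
      using q_ge comp_exp_nonneg[of "u l"] fu[OF that] by (auto intro!: mult_left_mono)
    ultimately have "\<bar>g l\<bar> \<le> 2 * (q * (z l * \<mu> l))" using g_diff[OF that] by linarith
    then have "\<beta> l * \<bar>g l\<bar> \<le> \<beta> l * (2 * (q * (z l * \<mu> l)))" using \<beta>[of l] by (intro mult_left_mono) auto
    also have "\<dots> = 2 * a * (q * real h) * \<mu> l" using \<beta>z[of l] by (simp add: algebra_simps)
    also have "\<dots> \<le> 2 * a * c * \<mu> l" using qh a \<mu> by (intro mult_right_mono mult_left_mono) auto
    finally show ?thesis using \<beta>[of l] by (simp add: abs_mult)
  qed
  have sum_\<mu>: "(\<Sum>l<j. \<mu> l) \<le> V" if "j \<le> h" for j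
  proof -
    have "(\<Sum>l<j. \<mu> l) \<le> (\<Sum>l<h. \<mu> l)"
      using that \<mu> by (intro sum_mono2) auto
    also have "\<dots> \<le> (\<Sum>l<h. real (h - l) * \<mu> l)"
    proof (rule sum_mono)
      fix l assume "l \<in> {..<h}"
      then have "1 * \<mu> l \<le> real (h - l) * \<mu> l" using \<mu>[of l] by (intro mult_right_mono) auto
      then show "\<mu> l \<le> real (h - l) * \<mu> l" by simp
    qed
    also have "\<dots> = V" by (simp add: V_def \<mu>_def z_def \<beta>_def)
    finally show ?thesis .
  qed
  \<comment> \<open>the weight of a subtree is its first-order value, up to terms that are small next to \<open>h\<close>\<close>
  have E: "\<beta> l * \<bar>u l - w l\<bar> \<le> 2 * a * c * V + a * (1 + c) * real (h - l) + a * K" if l: "l \<le> h" for l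
  proof -
    have "u l = s * mean_size b p l + (\<Sum>k<l. real b ^ (l - k) * p ^ (l - Suc k) * g k)"
      unfolding u_def g_def by (rule cumulant_unroll)
    then have "\<beta> l * u l = s * (\<beta> l * mean_size b p l) + (\<Sum>k<l. \<beta> l * (real b ^ (l - k) * p ^ (l - Suc k) * g k))"
      by (simp add: algebra_simps sum_distrib_left)
    also have "(\<Sum>k<l. \<beta> l * (real b ^ (l - k) * p ^ (l - Suc k) * g k)) = (\<Sum>k<l. p ^ (l - Suc k) * (\<beta> k * g k))"
    proof (rule sum.cong[OF refl])
      fix k assume "k \<in> {..<l}"
      then have "h - k = (h - l) + (l - k)" using l by auto
      then show "\<beta> l * (real b ^ (l - k) * p ^ (l - Suc k) * g k) = p ^ (l - Suc k) * (\<beta> k * g k)"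
        by (simp add: \<beta>_def power_add)
    qed
    finally have eq: "\<beta> l * u l = s * (\<beta> l * mean_size b p l) + (\<Sum>k<l. p ^ (l - Suc k) * (\<beta> k * g k))" .
    have "\<bar>\<Sum>k<l. p ^ (l - Suc k) * (\<beta> k * g k)\<bar> \<le> (\<Sum>k<l. 2 * a * c * \<mu> k)"
    proof (rule order_trans[OF sum_abs sum_mono])
      fix k assume k: "k \<in> {..<l}"
      have "p ^ (l - Suc k) \<le> 1" using p by (intro power_le_one) auto
      then have "\<bar>p ^ (l - Suc k)\<bar> * \<bar>\<beta> k * g k\<bar> \<le> 1 * (2 * a * c * \<mu> k)"
        using g_bound[of k] k l p by (intro mult_mono) auto
      then show "\<bar>p ^ (l - Suc k) * (\<beta> k * g k)\<bar> \<le> 2 * a * c * \<mu> k" by (simp add: abs_mult)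
    qed
    also have "\<dots> = 2 * a * c * (\<Sum>k<l. \<mu> k)" by (simp add: sum_distrib_left)
    also have "\<dots> \<le> 2 * a * c * V" using sum_\<mu>[OF l] a c by (intro mult_left_mono) auto
    finally have 1: "\<bar>\<Sum>k<l. p ^ (l - Suc k) * (\<beta> k * g k)\<bar> \<le> 2 * a * c * V" .
    have "\<bar>\<beta> l * mean_size b p l - mean_size b p h\<bar> \<le>
        reg_tree_size b h * (real (h - l) / real h + q * real (h - l))"
      using mean_size_ratio_bound[OF b _ p(2), of "h - l" h] l p by (simp add: \<beta>_def q_def)
    then have "s * \<bar>\<beta> l * mean_size b p l - mean_size b p h\<bar> \<le>
        s * (reg_tree_size b h * (real (h - l) / real h + q * real (h - l)))"
      using s by (rule mult_left_mono)
    also have "\<dots> = a * real (h - l) * (1 + q * real h)"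
      using n h0 by (simp add: s_def field_simps)
    also have "\<dots> \<le> a * real (h - l) * (1 + c)"
      using qh a by (intro mult_left_mono) auto
    also have "s * \<bar>\<beta> l * mean_size b p l - mean_size b p h\<bar> =
        \<bar>s * (\<beta> l * mean_size b p l) - s * mean_size b p h\<bar>"
      using s by (simp add: abs_mult flip: right_diff_distrib)
    finally have 2: "\<bar>s * (\<beta> l * mean_size b p l) - s * mean_size b p h\<bar> \<le> a * (1 + c) * real (h - l)"
      by (simp add: mult_ac)
    have "s * mean_size b p h - \<beta> l * w l = a * (real h * (mean_size b p h / reg_tree_size b h - exp (- c)))"
      unfolding \<beta>w by (simp add: s_def algebra_simps)
    then have 3: "\<bar>s * mean_size b p h - \<beta> l * w l\<bar> \<le> a * K"
      using K a by (simp add: abs_mult mult_left_mono)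
    have "\<beta> l * \<bar>u l - w l\<bar> = \<bar>\<beta> l * u l - \<beta> l * w l\<bar>"
      using \<beta>[of l] by (simp add: abs_mult flip: right_diff_distrib)
    also have "\<dots> \<le> 2 * a * c * V + a * (1 + c) * real (h - l) + a * K"
      unfolding eq using 1 2 3 by linarith
    finally show ?thesis .
  qed
  have V0: "0 \<le> V" using sum_\<mu>[of 0] by simp
  define D where "D = (4 * a * c\<^sup>2 + a * c * (1 + c + K)) / real h + 2 * a * c\<^sup>2 * V / real h"
  have K0: "0 \<le> K" using K h0 by (meson abs_ge_zero mult_nonneg_nonneg of_nat_0_le_iff order_trans)
  have D_part: "\<bar>\<beta> l * p ^ (h - Suc l) * g l - c / real h * (\<beta> l * comp_exp (w l))\<bar> \<le> D * (real (h - l) * \<mu> l)"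
    if l: "l < h" for l
  proof -
    define k where "k = h - Suc l"
    define \<nu> where "\<nu> = real (h - l) * \<mu> l"
    have \<mu>\<nu>: "\<mu> l \<le> \<nu>" unfolding \<nu>_def using l \<mu>[of l] mult_right_mono[of 1 "real (h - l)" "\<mu> l"] by simp
    have pk: "0 \<le> p ^ k" "p ^ k \<le> 1" using p by (auto intro: power_le_one)
    have fu0: "0 \<le> comp_exp (u l)" "0 \<le> comp_exp (w l)" by (simp_all add: comp_exp_nonneg)
    have qq: "q\<^sup>2 * real h \<le> c * (c / real h)"
    proof -
      have "q * (q * real h) \<le> (c / real h) * c" using q_ge q_le qh c h0 by (intro mult_mono) auto
      then show ?thesis by (simp add: power2_eq_square mult_ac)
    qed
    \<comment> \<open>the four errors: second order in \<open>q\<close>, the damping \<open>p ^ k\<close>, the weight, and \<open>q\<close> against \<open>c / h\<close>\<close>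
    have t1: "\<bar>\<beta> l * p ^ k * (g l - q * comp_exp (u l))\<bar> \<le> 2 * a * c\<^sup>2 / real h * \<nu>"
    proof -
      have "\<beta> l * p ^ k * \<bar>g l - q * comp_exp (u l)\<bar> \<le> \<beta> l * 1 * (2 * q\<^sup>2 * (z l * \<mu> l))"
        using \<beta>[of l] pk g_diff[of l] l by (intro mult_mono) auto
      also have "\<dots> = 2 * a * (q\<^sup>2 * real h) * \<mu> l" using \<beta>z[of l] by (simp add: algebra_simps)
      also have "\<dots> \<le> 2 * a * (c * (c / real h)) * \<nu>"
        by (rule mult_mono[OF mult_left_mono[OF qq]]) (use a \<mu>[of l] \<mu>\<nu> c h0 in auto)
      finally show ?thesis using \<beta>[of l] pk by (simp add: abs_mult power2_eq_square)
    qed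
    have t2: "\<bar>\<beta> l * (1 - p ^ k) * (q * comp_exp (u l))\<bar> \<le> a * c\<^sup>2 / real h * \<nu>"
    proof -
      have "1 - p ^ k \<le> real k * q"
        using Bernoulli_inequality[of "p - 1" k] p by (simp add: q_def algebra_simps)
      also have "\<dots> \<le> real (h - l) * q" using q_ge by (intro mult_right_mono) (auto simp: k_def)
      finally have k: "1 - p ^ k \<le> real (h - l) * q" .
      have "\<beta> l * (1 - p ^ k) * (q * comp_exp (u l)) \<le> \<beta> l * (real (h - l) * q) * (q * (z l * \<mu> l))"
        by (rule mult_mono[OF mult_left_mono[OF k] mult_left_mono[OF fu]])
           (use \<beta>[of l] q_ge fu0 l pk in auto)
      also have "\<dots> = a * (q\<^sup>2 * real h) * \<nu>"
        using \<beta>z[of l] by (simp add: \<nu>_def power2_eq_square algebra_simps)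
      also have "\<dots> \<le> a * (c * (c / real h)) * \<nu>"
        by (rule mult_right_mono[OF mult_left_mono[OF qq a]]) (use \<mu>[of l] \<mu>\<nu> in auto)
      finally show ?thesis using \<beta>[of l] pk q_ge fu0 by (simp add: abs_mult power2_eq_square)
    qed
    have t3: "\<bar>q * (\<beta> l * (comp_exp (u l) - comp_exp (w l)))\<bar> \<le>
        c / real h * (2 * a * c * V + a * (1 + c) + a * K) * \<nu>"
    proof -
      have "\<bar>comp_exp (u l) - comp_exp (w l)\<bar> \<le> \<bar>u l - w l\<bar> * \<mu> l"
        unfolding \<mu>_def using u[of l] w[of l] l by (intro comp_exp_lipschitz) auto
      then have "\<beta> l * \<bar>comp_exp (u l) - comp_exp (w l)\<bar> \<le> \<beta> l * (\<bar>u l - w l\<bar> * \<mu> l)"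
        using \<beta>[of l] by (intro mult_left_mono) auto
      also have "\<dots> = (\<beta> l * \<bar>u l - w l\<bar>) * \<mu> l" by simp
      also have "\<dots> \<le> (2 * a * c * V + a * (1 + c) * real (h - l) + a * K) * \<mu> l"
        using E[of l] l \<mu>[of l] by (intro mult_right_mono) auto
      also have "\<dots> = (2 * a * c * V + a * K) * \<mu> l + a * (1 + c) * \<nu>"
        by (simp add: \<nu>_def algebra_simps)
      also have "\<dots> \<le> (2 * a * c * V + a * K) * \<nu> + a * (1 + c) * \<nu>"
        using \<mu>\<nu> a c V0 K0 by (intro add_right_mono mult_left_mono) auto
      also have "\<dots> = (2 * a * c * V + a * (1 + c) + a * K) * \<nu>" by (simp add: algebra_simps)
      finally have f_diff: "\<beta> l * \<bar>comp_exp (u l) - comp_exp (w l)\<bar> \<le>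
          (2 * a * c * V + a * (1 + c) + a * K) * \<nu>" .
      have "q * (\<beta> l * \<bar>comp_exp (u l) - comp_exp (w l)\<bar>) \<le>
          (c / real h) * ((2 * a * c * V + a * (1 + c) + a * K) * \<nu>)"
        by (rule mult_mono[OF q_le f_diff]) (use \<beta>[of l] c h0 in auto)
      then show ?thesis using q_ge \<beta>[of l] by (simp add: abs_mult mult.assoc)
    qed
    have t4: "\<bar>(c / real h - q) * (\<beta> l * comp_exp (w l))\<bar> \<le> a * c\<^sup>2 / real h * \<nu>"
    proof -
      have "(c / real h - q) * (\<beta> l * comp_exp (w l)) \<le> ((c / real h) * (c / real h)) * (\<beta> l * (z l * \<mu> l))"
        by (rule mult_mono[OF q_diff(2) mult_left_mono[OF fw]]) (use \<beta>[of l] fu0 in auto)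
      also have "\<beta> l * (z l * \<mu> l) = a * real h * \<mu> l" using \<beta>z[of l] by (simp flip: mult.assoc)
      also have "((c / real h) * (c / real h)) * (a * real h * \<mu> l) = a * c\<^sup>2 / real h * \<mu> l"
        using h0 by (simp add: power2_eq_square field_simps)
      also have "\<dots> \<le> a * c\<^sup>2 / real h * \<nu>" using \<mu>\<nu> a h0 by (intro mult_left_mono) auto
      finally show ?thesis using q_diff \<beta>[of l] fu0 by (simp add: abs_mult)
    qed
    have triangle: "\<bar>x1 - x2 + x3 - x4\<bar> \<le> y1 + y2 + y3 + y4"
      if "\<bar>x1\<bar> \<le> y1" "\<bar>x2\<bar> \<le> y2" "\<bar>x3\<bar> \<le> y3" "\<bar>x4\<bar> \<le> y4" for x1 x2 x3 x4 y1 y2 y3 y4 :: real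
      using that by linarith
    have eq: "\<beta> l * p ^ k * g l - c / real h * (\<beta> l * comp_exp (w l)) =
        \<beta> l * p ^ k * (g l - q * comp_exp (u l)) - \<beta> l * (1 - p ^ k) * (q * comp_exp (u l))
        + q * (\<beta> l * (comp_exp (u l) - comp_exp (w l))) - (c / real h - q) * (\<beta> l * comp_exp (w l))"
      by (simp add: algebra_simps)
    have "\<bar>\<beta> l * p ^ k * g l - c / real h * (\<beta> l * comp_exp (w l))\<bar> \<le>
        2 * a * c\<^sup>2 / real h * \<nu> + a * c\<^sup>2 / real h * \<nu> +
        c / real h * (2 * a * c * V + a * (1 + c) + a * K) * \<nu> + a * c\<^sup>2 / real h * \<nu>"
      unfolding eq by (rule triangle[OF t1 t2 t3 t4])
    also have "\<dots> = D * \<nu>"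
      using h0 by (simp add: D_def field_simps power2_eq_square)
    finally show ?thesis by (simp add: k_def \<nu>_def)
  qed
  have "u h - s * mean_size b p h = (\<Sum>l<h. \<beta> l * p ^ (h - Suc l) * g l)"
    unfolding u_def g_def \<beta>_def by (subst cumulant_unroll) simp
  then have "\<bar>u h - s * mean_size b p h - c / real h * (\<Sum>l<h. \<beta> l * comp_exp (w l))\<bar> =
      \<bar>\<Sum>l<h. \<beta> l * p ^ (h - Suc l) * g l - c / real h * (\<beta> l * comp_exp (w l))\<bar>"
    by (simp only: sum_subtractf sum_distrib_left)
  also have "\<dots> \<le> (\<Sum>l<h. D * (real (h - l) * \<mu> l))"
    by (rule order_trans[OF sum_abs sum_mono]) (use D_part in auto)
  also have "\<dots> = D * V" by (simp add: V_def \<mu>_def z_def \<beta>_def sum_distrib_left)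
  also have "\<dots> = (4 * a * c\<^sup>2 + a * c * (1 + c + K)) * (V / real h) + 2 * a * c\<^sup>2 * (V\<^sup>2 / real h)"
    using h0 by (simp add: D_def field_simps power2_eq_square)
  finally show ?thesis by (simp add: u_def w_def \<beta>_def)
qed


section \<open>Convergence of the rescaled cluster size\<close>

lemma min_1_le_powr_quarter:
  assumes "0 \<le> x"
  shows "min 1 x \<le> x powr (1 / 4 :: real)"
proof (cases "x \<ge> 1")
  case True
  then show ?thesis using ge_one_powr_ge_zero[of x "1 / 4"] by simp
next
  case False
  then have "x powr 1 \<le> x powr (1 / 4)" using assms by (intro powr_mono') auto
  then show ?thesis using False assms by simp
qed

text \<open>
  The sum is of the order of \<open>(log h)^2\<close>; bounding \<open>min 1 x\<close> by a power of \<open>x\<close> makes it a convergent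
  series times a small power of \<open>h\<close>. The exponent \<open>1/4\<close> is below \<open>1/2\<close>, so that the square of the
  sum is still \<open>o(h)\<close>.
\<close>

lemma level_weight_bound:
  assumes B: "B > 1" and a: "0 \<le> a"
  obtains A where "0 \<le> A"
    "\<And>h. (\<Sum>l<h. real (h - l) * min 1 (a * real h / B ^ (h - l))) \<le> A * real h powr (1 / 4)"
proof
  define \<theta> where "\<theta> = B powr (- 1 / 4)"
  have \<theta>: "0 < \<theta>" "\<theta> < 1" using B by (auto simp: \<theta>_def powr_less_one)
  have sums: "(\<lambda>n. real (Suc n) * \<theta> ^ n) sums (1 / (1 - \<theta>)\<^sup>2)"
    using geometric_deriv_sums[of \<theta>] \<theta> by simp
  show "0 \<le> a powr (1 / 4) * (1 / (1 - \<theta>)\<^sup>2)" by simp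
  fix h
  have "(\<Sum>l<h. real (h - l) * min 1 (a * real h / B ^ (h - l))) \<le>
      (\<Sum>l<h. (a * real h) powr (1 / 4) * (real (Suc (h - Suc l)) * \<theta> ^ (h - Suc l)))"
  proof (rule sum_mono)
    fix l assume l: "l \<in> {..<h}"
    have "min 1 (a * real h / B ^ (h - l)) \<le> (a * real h / B ^ (h - l)) powr (1 / 4)"
      using a B by (intro min_1_le_powr_quarter) auto
    also have "\<dots> = (a * real h) powr (1 / 4) * \<theta> ^ (h - l)"
      using a B by (simp add: \<theta>_def powr_divide powr_power powr_minus_divide powr_powr flip: powr_realpow)
    also have "\<dots> \<le> (a * real h) powr (1 / 4) * \<theta> ^ (h - Suc l)"
      using \<theta> by (intro mult_left_mono power_decreasing) auto
    finally have "real (h - l) * min 1 (a * real h / B ^ (h - l)) \<le>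
        real (h - l) * ((a * real h) powr (1 / 4) * \<theta> ^ (h - Suc l))"
      by (intro mult_left_mono) auto
    also have "h - l = Suc (h - Suc l)" using l by auto
    finally show "real (h - l) * min 1 (a * real h / B ^ (h - l)) \<le>
      (a * real h) powr (1 / 4) * (real (Suc (h - Suc l)) * \<theta> ^ (h - Suc l))"
      using \<open>h - l = Suc (h - Suc l)\<close> by (simp only: mult_ac)
  qed
  also have "\<dots> = (a * real h) powr (1 / 4) * (\<Sum>n<h. real (Suc n) * \<theta> ^ n)"
    unfolding sum_distrib_left[symmetric] by (subst sum.nat_diff_reindex) simp
  also have "\<dots> \<le> (a * real h) powr (1 / 4) * (1 / (1 - \<theta>)\<^sup>2)"
  proof (rule mult_left_mono)
    show "(\<Sum>n<h. real (Suc n) * \<theta> ^ n) \<le> 1 / (1 - \<theta>)\<^sup>2"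
      unfolding sums_unique[OF sums] using \<theta>
      by (intro sum_le_suminf sums_summable[OF sums]) auto
  qed simp
  finally show "(\<Sum>l<h. real (h - l) * min 1 (a * real h / B ^ (h - l))) \<le>
      a powr (1 / 4) * (1 / (1 - \<theta>)\<^sup>2) * real h powr (1 / 4)"
    using a by (simp add: powr_mult mult_ac)
qed

text \<open>
  Up to exponentially small terms, the mean is the fraction \<open>e^(-c-c/h) (b - 1) / (b e^(-c/h) - 1)\<close>
  of the tree, whose expansion to order \<open>1/h\<close> yields the deterministic shift \<open>c / (b - 1)\<close> in the
  limit law.
\<close>

lemma mean_size_limit:
  assumes b: "b \<ge> 2"
  shows "(\<lambda>h. real h * (mean_size b (exp (- c / real h)) h / reg_tree_size b h - exp (- c)))
           \<longlonglongrightarrow> exp (- c) * c / (real b - 1)"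
proof -
  define B where "B = real b"
  have B: "B > 1" using b by (simp add: B_def)
  \<comment> \<open>the closed form of the mean, divided through by \<open>B ^ (h + 1)\<close>\<close>
  have "(\<lambda>h. real h * ((exp (- c - c / real h) - (1 / B) ^ (h + 1)) * (B - 1) /
            ((B * exp (- c / real h) - 1) * (1 - (1 / B) ^ (h + 1))) - exp (- c)))
      \<longlonglongrightarrow> exp (- c) * c / (B - 1)"
  proof -
    have "exp (- c) * (B - 1) * (i * (i * (B * c))) - exp (- c) * c * (B - 1) * i = exp (- c) * c * i"
      if "(B - 1) * i = 1" for i
      using that by algebra
    from this[of "inverse (B - 1)"] show ?thesis
      using B by real_asymp (simp add: divide_inverse)
  qed
  moreover have "\<forall>\<^sub>F h in sequentially.
      real h * ((exp (- c - c / real h) - (1 / B) ^ (h + 1)) * (B - 1) /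
            ((B * exp (- c / real h) - 1) * (1 - (1 / B) ^ (h + 1))) - exp (- c)) =
      real h * (mean_size b (exp (- c / real h)) h / reg_tree_size b h - exp (- c))"
  proof -
    have "\<forall>\<^sub>F h in sequentially. B * exp (- c / real h) > 1" using B by real_asymp
    then show ?thesis using eventually_gt_at_top[of 0]
    proof eventually_elim
      case (elim h)
      define p N e where "p = exp (- c / real h)" and "N = B ^ (h + 1)" and "e = exp (- c - c / real h)"
      have "N > 1" using B by (simp add: N_def del: power_Suc)
      have "real (h + 1) * (- c / real h) = - c - c / real h"
        using elim by (simp add: field_simps)
      then have "p ^ (h + 1) = e"
        unfolding p_def e_def by (metis exp_of_nat_mult)
      then have "mean_size b p h = (N * e - 1) / (B * p - 1)"
        using sum_gp0[of "B * p" h] elim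
        by (simp add: mean_size_def B_def[symmetric] N_def p_def power_mult_distrib field_simps)
      moreover have "reg_tree_size b h = (N - 1) / (B - 1)"
        by (simp add: reg_tree_size_def N_def B_def)
      moreover have "(1 / B) ^ (h + 1) = 1 / N" by (simp add: N_def power_divide)
      moreover have "(e - 1 / N) * (B - 1) / ((B * p - 1) * (1 - 1 / N)) =
          (N * e - 1) / (B * p - 1) / ((N - 1) / (B - 1))"
        using \<open>N > 1\<close> B elim(1) by (simp add: p_def[symmetric] divide_simps)
      ultimately show ?case by (simp only: p_def[symmetric] e_def[symmetric])
    qed
  qed
  ultimately show ?thesis
    unfolding B_def by (rule Lim_transform_eventually)
qed

text \<open>
  The mean contributes the summand with \<open>c / (b - 1)\<close>, the compensated sum the Laplace exponent and
  the summand with \<open>\<rho>\<close>; the error of \<open>cumulant_expansion\<close> vanishes by \<open>level_weight_bound\<close>.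
\<close>

lemma cumulant_limit:
  fixes h :: "nat \<Rightarrow> nat"
  assumes b: "b \<ge> 2" and a: "0 \<le> a" and c: "0 < c" and \<rho>: "0 \<le> \<rho>" "\<rho> < 1"
    and h: "filterlim h at_top sequentially"
    and frac: "(\<lambda>k. frac (log (real b) (real (h k)))) \<longlonglongrightarrow> \<rho>"
  shows "(\<lambda>k. cumulant b (exp (- c / real (h k))) (a * real (h k) / reg_tree_size b (h k)) (h k)
              - a * exp (- c) * real (h k) - a * exp (- c) * c * log (real b) (real (h k)))
         \<longlonglongrightarrow> a * exp (- c) * c / (real b - 1) + c * (Psi b \<rho> (a * exp (- c)) - a * exp (- c) * \<rho>)"
proof -
  define \<alpha> where "\<alpha> = a * exp (- c)"
  define U where "U n = cumulant b (exp (- c / real n)) (a * real n / reg_tree_size b n) n" for n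
  define E where "E n = real n * (mean_size b (exp (- c / real n)) n / reg_tree_size b n - exp (- c))" for n
  define T where "T n = (\<Sum>l<n. real b ^ (n - l) * comp_exp (\<alpha> * real n / real b ^ (n - l))) / real n" for n
  define V where "V n = (\<Sum>l<n. real (n - l) * min 1 (a * real n / real b ^ (n - l)))" for n
  have E_lim: "E \<longlonglongrightarrow> exp (- c) * c / (real b - 1)"
    unfolding E_def by (rule mean_size_limit[OF b])
  then obtain K where K: "\<And>n. \<bar>E n\<bar> \<le> K"
    using convergent_imp_Bseq[of E] by (auto simp: convergent_def Bseq_def)
  have V0: "0 \<le> V n" for n
    unfolding V_def using a by (intro sum_nonneg) auto
  obtain A where A: "0 \<le> A" "\<And>n. V n \<le> A * real n powr (1 / 4)"
    using level_weight_bound[of "real b" a] a b unfolding V_def by auto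
  have VL: "(\<lambda>n. V n / real n) \<longlonglongrightarrow> 0"
  proof (rule tendsto_sandwich[OF _ _ tendsto_const])
    show "\<forall>\<^sub>F n in sequentially. 0 \<le> V n / real n" using V0 by simp
    show "\<forall>\<^sub>F n in sequentially. V n / real n \<le> A * (real n powr (1 / 4) / real n)"
      using A(2) by (intro always_eventually allI) (auto intro: divide_right_mono)
    have "(\<lambda>n. real n powr (1 / 4) / real n) \<longlonglongrightarrow> 0" by real_asymp
    then show "(\<lambda>n. A * (real n powr (1 / 4) / real n)) \<longlonglongrightarrow> 0" by (rule tendsto_mult_right_zero)
  qed
  have VQ: "(\<lambda>n. (V n)\<^sup>2 / real n) \<longlonglongrightarrow> 0"
  proof (rule tendsto_sandwich[OF _ _ tendsto_const])
    show "\<forall>\<^sub>F n in sequentially. 0 \<le> (V n)\<^sup>2 / real n" by simp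
    have "(V n)\<^sup>2 / real n \<le> A\<^sup>2 * ((real n powr (1 / 4))\<^sup>2 / real n)" for n
      using divide_right_mono[OF power_mono[OF A(2)[of n] V0, of 2], of "real n"]
      by (simp add: power_mult_distrib)
    then show "\<forall>\<^sub>F n in sequentially. (V n)\<^sup>2 / real n \<le> A\<^sup>2 * ((real n powr (1 / 4))\<^sup>2 / real n)"
      by (intro always_eventually allI)
    have "(\<lambda>n. (real n powr (1 / 4))\<^sup>2 / real n) \<longlonglongrightarrow> 0" by real_asymp
    then show "(\<lambda>n. A\<^sup>2 * ((real n powr (1 / 4))\<^sup>2 / real n)) \<longlonglongrightarrow> 0" by (rule tendsto_mult_right_zero)
  qed
  have diff: "(\<lambda>n. U n - \<alpha> * real n - a * E n - c * T n) \<longlonglongrightarrow> 0"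
  proof (rule Lim_null_comparison)
    define X where "X n = (4 * a * c\<^sup>2 + a * c * (1 + c + K)) * (V n / real n) + 2 * a * c\<^sup>2 * ((V n)\<^sup>2 / real n)" for n
    show "X \<longlonglongrightarrow> 0"
      unfolding X_def by (intro tendsto_add_zero tendsto_mult_right_zero VL VQ)
    have "\<forall>\<^sub>F n in sequentially. n \<ge> 1 \<and> 2 * c \<le> real n"
      by (intro eventually_conj eventually_ge_at_top) (real_asymp)
    then show "\<forall>\<^sub>F n in sequentially. norm (U n - \<alpha> * real n - a * E n - c * T n) \<le> X n"
    proof eventually_elim
      case (elim n)
      have "real n * \<bar>mean_size b (exp (- c / real n)) n / reg_tree_size b n - exp (- c)\<bar> \<le> K"
        using K[of n] by (simp add: E_def abs_mult)
      from cumulant_expansion[OF b a c _ _ this refl refl refl] elim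
      have "\<bar>U n - a * real n / reg_tree_size b n * mean_size b (exp (- c / real n)) n - c * T n\<bar> \<le> X n"
        by (simp add: X_def U_def T_def V_def \<alpha>_def)
      moreover have "a * real n / reg_tree_size b n * mean_size b (exp (- c / real n)) n = \<alpha> * real n + a * E n"
        by (simp add: E_def \<alpha>_def algebra_simps)
      ultimately show ?case by (simp add: algebra_simps)
    qed
  qed
  have "(\<lambda>k. T (h k) - \<alpha> * log (real b) (real (h k))) \<longlonglongrightarrow> Psi b \<rho> \<alpha> - \<alpha> * \<rho>"
    unfolding T_def using a by (intro compensated_sum_limit[OF b _ \<rho> h frac]) (simp add: \<alpha>_def)
  then have "(\<lambda>k. (U (h k) - \<alpha> * real (h k) - a * E (h k) - c * T (h k)) + a * E (h k) +
        c * (T (h k) - \<alpha> * log (real b) (real (h k)))) \<longlonglongrightarrow>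
      0 + a * (exp (- c) * c / (real b - 1)) + c * (Psi b \<rho> \<alpha> - \<alpha> * \<rho>)"
    by (intro tendsto_add tendsto_mult tendsto_const filterlim_compose[OF diff h] filterlim_compose[OF E_lim h])
  then show ?thesis
    by (simp add: U_def \<alpha>_def algebra_simps)
qed

theorem theorem5:
  fixes b :: nat and c \<rho> :: real and h :: "nat \<Rightarrow> nat"
    and M :: "'a measure" and L :: "real \<Rightarrow> 'a \<Rightarrow> real"
  assumes "b \<ge> 2" and "c > 0" and "0 \<le> \<rho>" and "\<rho> < 1"
    and "filterlim h at_top sequentially"
    and "(\<lambda>k. frac (log (real b) (real (h k)))) \<longlonglongrightarrow> \<rho>"
    and "levy_process M L" and "no_negative_jumps M L"
    and "has_laplace_exponent M L (Psi b \<rho>)"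
  shows "weak_conv_m
    (\<lambda>k. distr
       (measure_pmf (bond_percolation (reg_tree_edges b (h k)) (exp (- c / real (h k))))) borel
       (\<lambda>\<omega>. (real (root_cluster_size b (h k) \<omega>) / reg_tree_size b (h k) - exp (- c)) * real (h k)
             - c * exp (- c) * log (real b) (real (h k))))
    (distr M borel (\<lambda>\<omega>. - exp (- c) * (L c \<omega> + c * \<rho> - c / (real b - 1))))"
proof -
  define X where "X k \<omega> = (real (root_cluster_size b (h k) \<omega>) / reg_tree_size b (h k) - exp (- c)) * real (h k)
             - c * exp (- c) * log (real b) (real (h k))" for k \<omega>
  define Y where "Y \<omega> = - exp (- c) * (L c \<omega> + c * \<rho> - c / (real b - 1))" for \<omega>
  define P where "P k = tree_percolation b (exp (- c / real (h k))) (h k)" for k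
  define u where "u a k = cumulant b (exp (- c / real (h k))) (a * real (h k) / reg_tree_size b (h k)) (h k)
              - a * exp (- c) * real (h k) - a * exp (- c) * c * log (real b) (real (h k))" for a k
  interpret prob_space M using assms(7) by (simp add: levy_process_def)
  have [measurable]: "L c \<in> borel_measurable M"
    using assms(2,7) by (simp add: levy_process_def)
  have Y_meas [measurable]: "Y \<in> borel_measurable M"
    unfolding Y_def by measurable
  have mgf_X: "(\<integral>x. exp (a * x) \<partial>distr (measure_pmf (P k)) borel (X k)) = exp (u a k)" for a k
  proof -
    define s where "s = a * real (h k) / reg_tree_size b (h k)"
    have "(\<integral>x. exp (a * x) \<partial>distr (measure_pmf (P k)) borel (X k)) = (\<integral>\<omega>. exp (a * X k \<omega>) \<partial>P k)"
      by (rule integral_distr) auto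
    also have "\<dots> = (\<integral>\<omega>. exp (- a * exp (- c) * real (h k) - a * exp (- c) * c * log (real b) (real (h k))) *
        exp (s * real (root_cluster_size b (h k) \<omega>)) \<partial>P k)"
      by (rule Bochner_Integration.integral_cong[OF refl])
         (simp add: X_def s_def algebra_simps flip: exp_add)
    also have "\<dots> = exp (u a k)"
      unfolding P_def integral_mult_right_zero using assms(2)
      by (subst mgf_root_cluster_size) (auto simp: u_def s_def algebra_simps simp flip: exp_add)
    finally show ?thesis .
  qed
  have mgf_Y: "integrable M (\<lambda>\<omega>. exp (a * Y \<omega>))"
      "(\<integral>\<omega>. exp (a * Y \<omega>) \<partial>M) =
        exp (a * exp (- c) * c / (real b - 1) + c * (Psi b \<rho> (a * exp (- c)) - a * exp (- c) * \<rho>))"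
    if "a > 0" for a
  proof -
    define \<alpha> where "\<alpha> = a * exp (- c)"
    have \<alpha>: "0 \<le> \<alpha>" using that by (simp add: \<alpha>_def)
    have L: "integrable M (\<lambda>\<omega>. exp (- \<alpha> * L c \<omega>))" "(\<integral>\<omega>. exp (- \<alpha> * L c \<omega>) \<partial>M) = exp (c * Psi b \<rho> \<alpha>)"
      using assms(2,9) \<alpha> unfolding has_laplace_exponent_def by (meson less_imp_le)+
    have eq: "exp (a * Y \<omega>) = exp (\<alpha> * c / (real b - 1) - \<alpha> * c * \<rho>) * exp (- \<alpha> * L c \<omega>)" for \<omega>
      by (simp add: Y_def \<alpha>_def algebra_simps flip: exp_add)
    show "integrable M (\<lambda>\<omega>. exp (a * Y \<omega>))"
      unfolding eq using L(1) by (rule integrable_mult_right)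
    show "(\<integral>\<omega>. exp (a * Y \<omega>) \<partial>M) =
        exp (a * exp (- c) * c / (real b - 1) + c * (Psi b \<rho> (a * exp (- c)) - a * exp (- c) * \<rho>))"
      unfolding eq integral_mult_right_zero L(2) \<alpha>_def[symmetric]
      by (simp add: algebra_simps flip: exp_add)
  qed
  have "weak_conv_m (\<lambda>k. distr (measure_pmf (P k)) borel (X k)) (distr M borel Y)"
  proof (rule weak_conv_of_mgf)
    show "real_distribution (distr (measure_pmf (P k)) borel (X k))" for k
      by (rule prob_space.real_distribution_distr[OF prob_space_measure_pmf]) simp
    show "real_distribution (distr M borel Y)"
      by (rule real_distribution_distr) simp
    show "integrable (distr (measure_pmf (P k)) borel (X k)) (\<lambda>x. exp (a * x))" for k a
      by (subst integrable_distr_eq) (auto simp: P_def)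
    show "integrable (distr M borel Y) (\<lambda>x. exp (a * x))" if "a > 0" for a
      using mgf_Y(1)[OF that] by (subst integrable_distr_eq) auto
    show "(\<lambda>k. \<integral>x. exp (a * x) \<partial>distr (measure_pmf (P k)) borel (X k)) \<longlonglongrightarrow>
        (\<integral>x. exp (a * x) \<partial>distr M borel Y)" if "a > 0" for a
    proof -
      have "(\<integral>x. exp (a * x) \<partial>distr M borel Y) = (\<integral>\<omega>. exp (a * Y \<omega>) \<partial>M)"
        by (rule integral_distr) auto
      then show ?thesis
        unfolding mgf_X mgf_Y(2)[OF that] u_def using that assms(1-6)
        by (simp only:) (intro tendsto_exp cumulant_limit, auto)
    qed
  qed
  then show ?thesis
    by (simp add: X_def[abs_def] Y_def[abs_def] P_def)
qed

end
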